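(* Let $s\ge3$ be an integer and let $M$ be a real analytic Bishop surface defined near $0$ by an equation of the form $$w=H(z,\bar z)=z\bar z+2\,\mathrm{Re}\Big\{z^s+\sum_{k\ge1,\ j=2,\dots,s-1}a_{ks+j}z^{ks+j}\Big\}\quad\text{with infinitely many } a_{ks+j}\ne0.$$ For $N>s$ let $M_N$ be the Bishop surface defined by the $N$-th order truncation of the Taylor expansion of $H$ at $0$: $$w=z\bar z+2\,\mathrm{Re}\Big\{z^s+\sum_{k\ge1,\ j=2,\dots,s-1,\ ks+j\le N}a_{ks+j}z^{ks+j}\Big\}.$$ Then for any $N>s$, $(M,0)$ is not equivalent to $(M_N,0)$. In fact, for $N'>N>s$, $(M_N,0)$ is equivalent to $(M_{N'},0)$ if and only if $a_{ks+j}=0$ for all $k\ge1$, $2\le j\le s-1$ with $N<ks+j\le N'$. Here "equivalent" means formally equivalent (in particular $(M,0)$ is not holomorphically equivalent to $(M_N,0)$).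
   Context: Coordinates on $\mathbb C^2$ are $(z,w)$. A formal transformation is a pair $F=(F_1,F_2)$ of formal power series in $(z,w)$ without constant term with invertible Jacobian matrix at $0$. It maps $M=\{w=H(z,\bar z)\}$ to $M'=\{w'=H'(z',\overline{z'})\}$ if substituting $w=H(z,\bar z)$ gives $F_2(z,w)=H'\big(F_1(z,w),\overline{F_1(z,w)}\big)$ identically as formal power series in $(z,\bar z)$; then $(M,0)$ and $(M',0)$ are formally equivalent. They are holomorphically equivalent if such an $F$ can be chosen convergent. *)

theory Defs
  imports "HOL-Analysis.Analysis" "HOL-Computational_Algebra.Formal_Power_Series"
begin

text \<open>
  A formal power series in two commuting variables \<open>(x, y)\<close> is a nested series, an element of
  \<open>\<complex>[[x]][[y]]\<close>: the inner variable is the first one, the outer variable the second one.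
  The same type serves for series in \<open>(z, w)\<close> and for series in \<open>(z, zbar)\<close>, the latter being
  treated as independent variables.  A surface \<open>w = H(z, zbar)\<close> is represented by the Taylor
  series of \<open>H\<close> at \<open>0\<close>.
\<close>

type_synonym fps2 = "complex fps fps"

definition coeff2 :: "fps2 \<Rightarrow> nat \<Rightarrow> nat \<Rightarrow> complex" where
  "coeff2 F i j = fps_nth (fps_nth F j) i"

abbreviation var1 :: fps2 where "var1 \<equiv> fps_const fps_X"
abbreviation var2 :: fps2 where "var2 \<equiv> fps_X"

text \<open>
  The substitution \<open>F(A, B)\<close>, meaningful when \<open>A\<close> and \<open>B\<close> have no constant term: then
  \<open>A ^ i * B ^ j\<close> only has terms of total degree at least \<open>i + j\<close>, so the pairs left out of the
  sum contribute nothing (lemma \<open>subst2_omitted_terms\<close>).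
\<close>

definition subst2 :: "fps2 \<Rightarrow> fps2 \<Rightarrow> fps2 \<Rightarrow> fps2" where
  "subst2 F A B = Abs_fps (\<lambda>n. Abs_fps (\<lambda>m.
     \<Sum>(i, j) \<in> {(i, j). i + j \<le> m + n}. coeff2 F i j * coeff2 (A ^ i * B ^ j) m n))"

text \<open>
  Complex conjugation of a series in \<open>(z, zbar)\<close>: it conjugates the coefficients and exchanges
  \<open>z\<close> and \<open>zbar\<close>.
\<close>

definition conj2 :: "fps2 \<Rightarrow> fps2" where
  "conj2 G = Abs_fps (\<lambda>n. Abs_fps (\<lambda>m. cnj (coeff2 G n m)))"

text \<open>Truncation at total order \<open>N\<close>, the terms of order \<open>N\<close> being kept.\<close>

definition trunc2 :: "nat \<Rightarrow> fps2 \<Rightarrow> fps2" where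
  "trunc2 N G = Abs_fps (\<lambda>n. Abs_fps (\<lambda>m. if m + n \<le> N then coeff2 G m n else 0))"

text \<open>
  Convergence near the origin of \<open>\<complex>\<^sup>2\<close>.  For a series in \<open>(z, zbar)\<close> this says that it is the
  Taylor series of a function which is real analytic near \<open>0 \<in> \<complex>\<close>.
\<close>

definition convergent2 :: "fps2 \<Rightarrow> bool" where
  "convergent2 F \<longleftrightarrow> (\<exists>r>0. (\<lambda>(i, j). norm (coeff2 F i j) * r ^ (i + j)) summable_on UNIV)"

definition jacobian_at_0 :: "fps2 \<Rightarrow> fps2 \<Rightarrow> complex^2^2" where
  "jacobian_at_0 F1 F2 =
     vector [vector [coeff2 F1 1 0, coeff2 F1 0 1], vector [coeff2 F2 1 0, coeff2 F2 0 1]]"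

definition formal_transformation :: "fps2 \<Rightarrow> fps2 \<Rightarrow> bool" where
  "formal_transformation F1 F2 \<longleftrightarrow>
     coeff2 F1 0 0 = 0 \<and> coeff2 F2 0 0 = 0 \<and> invertible (jacobian_at_0 F1 F2)"

text \<open>\<open>(F1, F2)\<close> maps \<open>w = H(z, zbar)\<close> to \<open>w' = H'(z', z'bar)\<close>.\<close>

definition maps_surface :: "fps2 \<Rightarrow> fps2 \<Rightarrow> fps2 \<Rightarrow> fps2 \<Rightarrow> bool" where
  "maps_surface F1 F2 H H' \<longleftrightarrow>
     subst2 F2 var1 H = subst2 H' (subst2 F1 var1 H) (conj2 (subst2 F1 var1 H))"

definition formally_equivalent :: "fps2 \<Rightarrow> fps2 \<Rightarrow> bool" where
  "formally_equivalent H H' \<longleftrightarrow>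
     (\<exists>F1 F2. formal_transformation F1 F2 \<and> maps_surface F1 F2 H H')"

definition holomorphically_equivalent :: "fps2 \<Rightarrow> fps2 \<Rightarrow> bool" where
  "holomorphically_equivalent H H' \<longleftrightarrow>
     (\<exists>F1 F2. formal_transformation F1 F2 \<and> convergent2 F1 \<and> convergent2 F2 \<and>
        maps_surface F1 F2 H H')"

text \<open>
  The exponents \<open>k s + j\<close> with \<open>k \<ge> 1\<close> and \<open>2 \<le> j \<le> s - 1\<close>.  An exponent determines \<open>k\<close> and
  \<open>j\<close>, so a coefficient family indexed by the exponent is no restriction.
\<close>

definition exponents :: "nat \<Rightarrow> nat set" where
  "exponents s = {k * s + j | k j. k \<ge> 1 \<and> j \<in> {2..s - 1}}"

text \<open>
  The series \<open>z zbar + 2 Re (z\<^sup>s + \<Sum> a\<^sub>k\<^sub>s\<^sub>+\<^sub>j z\<^sup>k\<^sup>s\<^sup>+\<^sup>j)\<close>, with \<open>2 Re G\<close> written as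
  \<open>G\<close> plus its conjugate.  Values of \<open>a\<close> outside \<open>exponents s\<close> play no role.
\<close>

definition bishop :: "nat \<Rightarrow> (nat \<Rightarrow> complex) \<Rightarrow> fps2" where
  "bishop s a =
     (let G = fps_const (fps_X ^ s + Abs_fps (\<lambda>n. if n \<in> exponents s then a n else 0))
      in var1 * var2 + (G + conj2 G))"

lemma coeff2_mult_eq_0:
  assumes "\<And>m n. m + n < p \<Longrightarrow> coeff2 A m n = 0" "\<And>m n. m + n < q \<Longrightarrow> coeff2 B m n = 0"
    and "m + n < p + q"
  shows "coeff2 (A * B) m n = 0"
proof -
  have "coeff2 A k i * coeff2 B (m - k) (n - i) = 0" if "i \<le> n" "k \<le> m" for i k
  proof (cases "k + i < p")
    case False
    then have "(m - k) + (n - i) < q" using assms(3) that by linarith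
    then show ?thesis using assms(2) by simp
  qed (simp add: assms(1))
  then show ?thesis
    unfolding coeff2_def fps_mult_nth fps_sum_nth by (intro sum.neutral ballI) simp
qed

lemma coeff2_power_eq_0:
  assumes "coeff2 A 0 0 = 0" "m + n < i"
  shows "coeff2 (A ^ i) m n = 0"
  using assms(2)
proof (induction i arbitrary: m n)
  case (Suc i)
  have "coeff2 A m n = 0" if "m + n < 1" for m n using assms(1) that by simp
  then show ?case
    using coeff2_mult_eq_0[of 1 A i "A ^ i" m n] Suc by simp
qed simp

lemma subst2_omitted_terms:
  assumes "coeff2 A 0 0 = 0" "coeff2 B 0 0 = 0" "m + n < i + j"
  shows "coeff2 (A ^ i * B ^ j) m n = 0"
  using coeff2_mult_eq_0[of i "A ^ i" j "B ^ j"] coeff2_power_eq_0 assms by blast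

lemma coeff2_bishop:
  "coeff2 (bishop s a) m n =
     (if m = 1 \<and> n = 1 then 1 else 0)
     + (if n = 0 then (if m = s then 1 else 0) + (if m \<in> exponents s then a m else 0) else 0)
     + (if m = 0 then (if n = s then 1 else 0) + (if n \<in> exponents s then cnj (a n) else 0) else 0)"
  by (auto simp: bishop_def coeff2_def conj2_def Let_def fps_X_power_iff)

text \<open>
  Truncating the surface amounts to dropping the summands \<open>a\<^sub>n z\<^sup>n\<close> with \<open>n > N\<close>.
\<close>

lemma trunc2_bishop:
  assumes "s \<ge> 3" "N > s"
  shows "trunc2 N (bishop s a) = bishop s (\<lambda>n. if n \<le> N then a n else 0)"
proof -
  have "coeff2 (trunc2 N (bishop s a)) m n =
        coeff2 (bishop s (\<lambda>n. if n \<le> N then a n else 0)) m n" for m n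
  proof -
    have "coeff2 (trunc2 N (bishop s a)) m n =
          (if m + n \<le> N then coeff2 (bishop s a) m n else 0)"
      by (simp add: trunc2_def coeff2_def)
    then show ?thesis using assms by (auto simp: coeff2_bishop)
  qed
  then show ?thesis by (intro fps_ext) (simp add: coeff2_def)
qed

end

theory Submission imports Defs "HOL-Computational_Algebra.Polynomial" begin

text \<open>
  Restrict everything to the curves \<open>z = t, zbar = x t\<^sup>s\<^sup>-\<^sup>1\<close> with \<open>x\<close> a complex parameter, on which \<open>w\<close> starts
  with \<open>(1 + x) t\<^sup>s\<close>; so \<open>z\<close> has weight \<open>1\<close>, \<open>zbar\<close> weight \<open>s - 1\<close> and \<open>w\<close> weight \<open>s\<close>.  Since both
  surfaces are given by real series, \<open>F\<^sub>2\<close> is real on the surface, which forces it to be a real series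
  in \<open>w\<close> alone.  Comparing the terms of weight \<open>s\<close> gives \<open>F = (\<alpha> z, w)\<close> to leading order, with
  \<open>\<bar>\<alpha>\<bar> = 1\<close> and \<open>\<alpha>\<^sup>s = 1\<close>.  At each higher weight \<open>m\<close> the still unknown coefficients of
  \<open>F\<close> and the difference \<open>a'\<^sub>m \<alpha>\<^sup>m - a\<^sub>m\<close> satisfy a linear identity between polynomials in \<open>y = 1 + x\<close>,
  whose only solution is zero.  So \<open>a'\<^sub>m \<alpha>\<^sup>m = a\<^sub>m\<close> for all exponents \<open>m\<close>, and equivalent
  surfaces have the same nonvanishing coefficients.
\<close>

subsection \<open>Leading terms of power series\<close>

lemma fps_X_power_dvd_iff:
  fixes A :: "'a::comm_ring_1 fps"
  shows "fps_X ^ n dvd A \<longleftrightarrow> (\<forall>i<n. fps_nth A i = 0)"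
proof
  assume "\<forall>i<n. fps_nth A i = 0"
  then have "A = fps_X ^ n * fps_shift n A"
    by (auto simp: fps_eq_iff fps_X_power_mult_nth)
  then show "fps_X ^ n dvd A" by (metis dvd_triv_left)
qed (auto elim!: dvdE simp: fps_X_power_mult_nth)

lemma fps_mult_nth_leading:
  fixes A B :: "'a::comm_ring_1 fps"
  assumes "fps_X ^ a dvd A" "fps_X ^ b dvd B"
  shows "fps_nth (A * B) (a + b) = fps_nth A a * fps_nth B b"
proof -
  obtain A' B' where "A = fps_X ^ a * A'" "B = fps_X ^ b * B'"
    using assms by (auto elim!: dvdE)
  moreover from this have "A * B = fps_X ^ (a + b) * (A' * B')"
    by (simp add: power_add mult_ac)
  ultimately show ?thesis by (simp add: fps_X_power_mult_nth)
qed

lemma fps_power_leading: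
  fixes A :: "'a::comm_ring_1 fps"
  assumes "fps_X ^ a dvd A"
  shows "fps_X ^ (a * n) dvd A ^ n" "fps_nth (A ^ n) (a * n) = fps_nth A a ^ n"
proof -
  show *: "fps_X ^ (a * n) dvd A ^ n" for n
    using dvd_power_same[OF assms, of n] by (simp add: power_mult)
  show "fps_nth (A ^ n) (a * n) = fps_nth A a ^ n"
    by (induction n) (simp_all add: fps_mult_nth_leading[OF assms *])
qed

lemma fps_monomial_leading:
  fixes A B :: "'a::comm_ring_1 fps"
  assumes "fps_X ^ a dvd A" "fps_X ^ b dvd B"
  shows "fps_X ^ (a * i + b * j) dvd A ^ i * B ^ j"
    "fps_nth (A ^ i * B ^ j) (a * i + b * j) = fps_nth A a ^ i * fps_nth B b ^ j"
proof -
  show "fps_X ^ (a * i + b * j) dvd A ^ i * B ^ j"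
    unfolding power_add by (intro mult_dvd_mono fps_power_leading assms)
  show "fps_nth (A ^ i * B ^ j) (a * i + b * j) = fps_nth A a ^ i * fps_nth B b ^ j"
    using fps_mult_nth_leading[OF fps_power_leading(1)[OF assms(1)] fps_power_leading(1)[OF assms(2)]]
    by (simp add: fps_power_leading(2) assms)
qed

lemma fps_X_power_dvd_nth:
  fixes A :: "'a::comm_ring_1 fps"
  shows "fps_X ^ n dvd A \<Longrightarrow> i < n \<Longrightarrow> fps_nth A i = 0"
  by (simp add: fps_X_power_dvd_iff)

text \<open>The difference is \<open>E\<close> times a sum of \<open>Suc n\<close> products of
  \<open>n\<close> factors \<open>P\<close> or \<open>P + E\<close>, each of order at least
  \<open>n * p\<close>. If \<open>p < e\<close>, then \<open>P + E\<close> and \<open>P\<close> have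
  the same leading coefficient, so all these products contribute equally and only the first-order
  Taylor term is visible.\<close>

lemma power_perturbation:
  fixes P E :: "'a::comm_ring_1 fps"
  assumes P: "fps_X ^ p dvd P" and E: "fps_X ^ e dvd E"
  shows "p \<le> e \<Longrightarrow> fps_X ^ (e + n * p) dvd (P + E) ^ Suc n - P ^ Suc n"
    and "p < e \<Longrightarrow> fps_nth ((P + E) ^ Suc n - P ^ Suc n) (e + n * p) =
      of_nat (Suc n) * fps_nth P p ^ n * fps_nth E e"
proof -
  have step: "(P + E) ^ Suc (Suc n) - P ^ Suc (Suc n) =
      (P + E) * ((P + E) ^ Suc n - P ^ Suc n) + E * P ^ Suc n" for n
    by (simp add: algebra_simps)
  have PE: "fps_X ^ p dvd P + E" if "p \<le> e"
    using P E that le_imp_power_dvd[OF that, of "fps_X :: 'a fps"] by (meson dvd_add dvd_trans)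
  have EP: "fps_X ^ (e + p * Suc n) dvd E * P ^ Suc n" for n
    unfolding power_add by (intro mult_dvd_mono E fps_power_leading(1) P)
  show dvd: "fps_X ^ (e + n * p) dvd (P + E) ^ Suc n - P ^ Suc n" if "p \<le> e" for n
  proof (induction n)
    case (Suc n)
    have "fps_X ^ (p + (e + n * p)) dvd (P + E) * ((P + E) ^ Suc n - P ^ Suc n)"
      unfolding power_add[of _ p] by (intro mult_dvd_mono PE Suc that)
    then show ?case
      unfolding step using EP[of n] by (intro dvd_add) (simp_all add: algebra_simps)
  qed (simp add: E)
  assume "p < e"
  then have PEp: "fps_nth (P + E) p = fps_nth P p"
    using E by (simp add: fps_X_power_dvd_nth)
  show "fps_nth ((P + E) ^ Suc n - P ^ Suc n) (e + n * p) =
      of_nat (Suc n) * fps_nth P p ^ n * fps_nth E e"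
  proof (induction n)
    case (Suc n)
    have "fps_nth ((P + E) * ((P + E) ^ Suc n - P ^ Suc n)) (p + (e + n * p)) =
        fps_nth P p * (of_nat (Suc n) * fps_nth P p ^ n * fps_nth E e)"
      using fps_mult_nth_leading[OF PE dvd] \<open>p < e\<close> PEp Suc by (metis less_imp_le)
    moreover have "fps_nth (E * P ^ Suc n) (e + p * Suc n) = fps_nth E e * fps_nth P p ^ Suc n"
      using fps_mult_nth_leading[OF E fps_power_leading(1)[OF P]] fps_power_leading(2)[OF P] by metis
    moreover have "p + (e + n * p) = e + Suc n * p" "e + p * Suc n = e + Suc n * p"
      by (simp_all add: algebra_simps)
    ultimately show ?case
      unfolding step fps_add_nth by (simp add: algebra_simps)
  qed simp
qed

text \<open>
  The composition \<open>\<Sum> c\<^sub>i\<^sub>j P\<^sup>i Q\<^sup>j\<close>, meaningful when \<open>P\<close> and \<open>Q\<close> have no constant term.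
\<close>

definition eval2 :: "(nat \<Rightarrow> nat \<Rightarrow> complex) \<Rightarrow> complex fps \<Rightarrow> complex fps \<Rightarrow> complex fps" where
  "eval2 c P Q = Abs_fps (\<lambda>m. \<Sum>i\<le>m. \<Sum>j\<le>m. c i j * fps_nth (P ^ i * Q ^ j) m)"

lemma monomial_nth_eq_0:
  fixes P Q :: "complex fps"
  assumes "fps_nth P 0 = 0" "fps_nth Q 0 = 0" "m < i + j"
  shows "fps_nth (P ^ i * Q ^ j) m = 0"
proof -
  have "fps_X ^ (1 * i + 1 * j) dvd P ^ i * Q ^ j"
    by (rule fps_monomial_leading) (simp_all add: fps_X_power_dvd_iff[of 1, simplified] assms)
  then show ?thesis using assms(3) by (simp add: fps_X_power_dvd_iff)
qed

text \<open>Monomials of total degree above \<open>m\<close> do not reach order \<open>m\<close>, so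
  the index set may be any finite one containing the triangle.\<close>

lemma eval2_nth:
  assumes "fps_nth P 0 = 0" "fps_nth Q 0 = 0" "finite S" "\<And>i j. i + j \<le> m \<Longrightarrow> (i, j) \<in> S"
  shows "fps_nth (eval2 c P Q) m = (\<Sum>(i, j)\<in>S. c i j * fps_nth (P ^ i * Q ^ j) m)"
proof -
  have outside: "fps_nth (P ^ i * Q ^ j) m = 0" if "\<not> i + j \<le> m" for i j
    using monomial_nth_eq_0[OF assms(1,2)] that by simp
  then have outside: "(i, j) \<notin> S \<Longrightarrow> fps_nth (P ^ i * Q ^ j) m = 0"
    "\<not> i \<le> m \<Longrightarrow> fps_nth (P ^ i * Q ^ j) m = 0"
    "\<not> j \<le> m \<Longrightarrow> fps_nth (P ^ i * Q ^ j) m = 0" for i j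
    using assms(4)[of i j] by (cases "i + j \<le> m"; simp)+
  have "fps_nth (eval2 c P Q) m = (\<Sum>(i, j)\<in>{..m} \<times> {..m}. c i j * fps_nth (P ^ i * Q ^ j) m)"
    by (simp add: eval2_def sum.cartesian_product)
  \<comment> \<open>Neither index set need contain the other, so both are compared with their
    intersection.\<close>
  also have "\<dots> = (\<Sum>(i, j)\<in>S \<inter> {..m} \<times> {..m}. c i j * fps_nth (P ^ i * Q ^ j) m)"
    by (rule sum.mono_neutral_right) (use outside in \<open>(auto, blast+)\<close>)
  also have "\<dots> = (\<Sum>(i, j)\<in>S. c i j * fps_nth (P ^ i * Q ^ j) m)"
    by (rule sum.mono_neutral_left) (use outside assms(3) in \<open>(auto, blast+)\<close>)
  finally show ?thesis .
qed

lemma eval2_add: "eval2 (\<lambda>i j. c i j + d i j) P Q = eval2 c P Q + eval2 d P Q"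
  by (simp add: eval2_def fps_eq_iff sum.distrib algebra_simps)

lemma eval2_cmult: "eval2 (\<lambda>i j. k * c i j) P Q = fps_const k * eval2 c P Q"
  by (simp add: eval2_def fps_eq_iff sum_distrib_left mult_ac)

lemma eval2_monomial:
  assumes "fps_nth P 0 = 0" "fps_nth Q 0 = 0"
  shows "eval2 (\<lambda>i j. if i = p \<and> j = q then 1 else 0) P Q = P ^ p * Q ^ q"
proof (rule fps_ext)
  fix m
  \<comment> \<open>The index set is enlarged so that it contains \<open>(p, q)\<close> even when
    \<open>p\<close> or \<open>q\<close> exceeds \<open>m\<close>.\<close>
  have "fps_nth (eval2 (\<lambda>i j. if i = p \<and> j = q then 1 else 0) P Q) m =
    (\<Sum>(i, j)\<in>{..max m p} \<times> {..max m q}.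
       (if i = p \<and> j = q then 1 else 0) * fps_nth (P ^ i * Q ^ j) m)"
    by (rule eval2_nth[OF assms]) auto
  also have "\<dots> = (\<Sum>x\<in>{..max m p} \<times> {..max m q}.
       if x = (p, q) then fps_nth (P ^ p * Q ^ q) m else 0)"
    by (rule sum.cong) (auto split: if_splits)
  also have "\<dots> = fps_nth (P ^ p * Q ^ q) m" by simp
  finally show "fps_nth (eval2 (\<lambda>i j. if i = p \<and> j = q then 1 else 0) P Q) m =
    fps_nth (P ^ p * Q ^ q) m" .
qed

text \<open>Gives \<open>P\<close> weight \<open>a\<close> and \<open>Q\<close> weight
  \<open>b\<close>. A monomial starts at the order equal to its weight, so at the lowest weight only
  leading coefficients matter. This turns identities between series into identities between
  polynomials.\<close>

lemma eval2_leading: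
  assumes PQ: "fps_X ^ a dvd P" "fps_X ^ b dvd Q" and ab: "a \<ge> 1" "b \<ge> 1"
    and c: "\<And>i j. a * i + b * j < k \<Longrightarrow> c i j = 0"
  shows "fps_X ^ k dvd eval2 c P Q"
    "fps_nth (eval2 c P Q) k =
       (\<Sum>(i, j)\<in>{(i, j). a * i + b * j = k}. c i j * (fps_nth P a ^ i * fps_nth Q b ^ j))"
proof -
  have 0: "fps_nth P 0 = 0" "fps_nth Q 0 = 0" using PQ ab by (auto intro: fps_X_power_dvd_nth)
  have *: "fps_nth (P ^ i * Q ^ j) m = 0" if "m < a * i + b * j" for i j m
    using fps_monomial_leading(1)[OF PQ] that by (rule fps_X_power_dvd_nth)
  have le: "i \<le> a * i + b * j" "j \<le> a * i + b * j" for i j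
    using ab by (auto intro: trans_le_add1 trans_le_add2)
  have "c i j * fps_nth (P ^ i * Q ^ j) m = 0" if "m < k" for i j m
    using c[of i j] *[of m i j] that by (cases "a * i + b * j < k") auto
  then show "fps_X ^ k dvd eval2 c P Q"
    by (auto simp: fps_X_power_dvd_iff eval2_def intro!: sum.neutral)
  have sub: "{(i, j). a * i + b * j = k} \<subseteq> {..k} \<times> {..k}" using le by auto
  have "fps_nth (eval2 c P Q) k = (\<Sum>(i, j)\<in>{..k} \<times> {..k}. c i j * fps_nth (P ^ i * Q ^ j) k)"
    by (rule eval2_nth[OF 0]) auto
  also have "\<dots> = (\<Sum>(i, j)\<in>{(i, j). a * i + b * j = k}. c i j * fps_nth (P ^ i * Q ^ j) k)"
  proof (rule sum.mono_neutral_right)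
    have "c i j * fps_nth (P ^ i * Q ^ j) k = 0" if "a * i + b * j \<noteq> k" for i j
      using c[of i j] *[of k i j] that by (cases "a * i + b * j < k") auto
    then show "\<forall>ij\<in>{..k} \<times> {..k} - {(i, j). a * i + b * j = k}.
        (case ij of (i, j) \<Rightarrow> c i j * fps_nth (P ^ i * Q ^ j) k) = 0"
      by (auto, blast)
  qed (use sub in auto)
  also have "\<dots> = (\<Sum>(i, j)\<in>{(i, j). a * i + b * j = k}. c i j * (fps_nth P a ^ i * fps_nth Q b ^ j))"
    by (rule sum.cong) (auto simp flip: fps_monomial_leading(2)[OF PQ])
  finally show "fps_nth (eval2 c P Q) k =
       (\<Sum>(i, j)\<in>{(i, j). a * i + b * j = k}. c i j * (fps_nth P a ^ i * fps_nth Q b ^ j))" .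
qed

text \<open>The coefficients of the holomorphic series whose doubled real part appears in
  \<open>bishop\<close>, with the values of \<open>a\<close> off \<open>exponents s\<close>
  erased.\<close>

definition bishop_coeff :: "nat \<Rightarrow> (nat \<Rightarrow> complex) \<Rightarrow> nat \<Rightarrow> complex" where
  "bishop_coeff s a n = (if n = s then 1 else 0) + (if n \<in> exponents s then a n else 0)"

lemma eval2_bishop_nth:
  assumes "fps_nth P 0 = 0" "fps_nth Q 0 = 0" "m \<ge> 1"
  shows "fps_nth (eval2 (coeff2 (bishop s a)) P Q) m = fps_nth (P * Q) m
    + (\<Sum>n\<le>m. bishop_coeff s a n * fps_nth (P ^ n) m)
    + (\<Sum>n\<le>m. cnj (bishop_coeff s a n) * fps_nth (Q ^ n) m)"
proof -
  have c: "coeff2 (bishop s a) = (\<lambda>i j. (if i = 1 \<and> j = 1 then 1 else 0) +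
      ((if j = 0 then bishop_coeff s a i else 0) +
       (if i = 0 then cnj (bishop_coeff s a j) else 0)))"
    by (intro ext) (auto simp: coeff2_bishop bishop_coeff_def)
  have "fps_nth (eval2 (\<lambda>i j. if j = 0 then bishop_coeff s a i else 0) P Q) m =
      (\<Sum>i\<le>m. \<Sum>j\<le>m. if j = 0 then bishop_coeff s a i * fps_nth (P ^ i) m else 0)"
    unfolding eval2_def fps_nth_Abs_fps by (intro sum.cong refl) auto
  moreover have "fps_nth (eval2 (\<lambda>i j. if i = 0 then cnj (bishop_coeff s a j) else 0) P Q) m =
      (\<Sum>i\<le>m. if i = 0 then (\<Sum>j\<le>m. cnj (bishop_coeff s a j) * fps_nth (Q ^ j) m) else 0)"
    unfolding eval2_def fps_nth_Abs_fps by (intro sum.cong refl) auto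
  ultimately show ?thesis
    unfolding c eval2_add eval2_monomial[OF assms(1,2)] by simp
qed

subsection \<open>Restriction to curves\<close>

text \<open>The restriction of a series in \<open>(z, zbar)\<close> to the curve \<open>z = t, zbar = x t\<^sup>r\<close>.\<close>

definition curve :: "nat \<Rightarrow> complex \<Rightarrow> fps2 \<Rightarrow> complex fps" where
  "curve r x A = Abs_fps (\<lambda>m. \<Sum>(p, q)\<in>{(p, q). p + r * q = m}. coeff2 A p q * x ^ q)"

lemma finite_weight: "r \<ge> 1 \<Longrightarrow> finite {(p, q). p + r * q = (m::nat)}"
  by (rule finite_subset[of _ "{..m} \<times> {..m}"]) (auto intro: trans_le_add2)

lemma coeff2_mult:
  "coeff2 (A * B) p q = (\<Sum>(i, j)\<in>{..p} \<times> {..q}. coeff2 A i j * coeff2 B (p - i) (q - j))"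
  by (simp add: coeff2_def fps_mult_nth fps_sum_nth atLeast0AtMost sum.cartesian_product[symmetric])
    (rule sum.swap)

text \<open>Restriction to a curve is a substitution, hence multiplicative; collecting coefficients
  by the weight \<open>p + r * q\<close> respects this because weights add.\<close>

lemma curve_mult:
  assumes "r \<ge> 1"
  shows "curve r x (A * B) = curve r x A * curve r x B"
proof (rule fps_ext)
  fix m
  let ?T = "\<lambda>m. {(p, q). p + r * q = (m::nat)}"
  have "fps_nth (curve r x (A * B)) m =
    (\<Sum>pq\<in>?T m. \<Sum>ij\<in>{..fst pq} \<times> {..snd pq}.
       coeff2 A (fst ij) (snd ij) * coeff2 B (fst pq - fst ij) (snd pq - snd ij) * x ^ snd pq)"
    by (simp add: curve_def coeff2_mult sum_distrib_right case_prod_unfold)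
  also have "\<dots> = (\<Sum>(pq, ij)\<in>(SIGMA pq:?T m. {..fst pq} \<times> {..snd pq}).
       coeff2 A (fst ij) (snd ij) * coeff2 B (fst pq - fst ij) (snd pq - snd ij) * x ^ snd pq)"
    by (rule sum.Sigma) (use finite_weight[OF assms] in auto)
  \<comment> \<open>An exponent pair of weight \<open>m\<close> with a chosen smaller pair is the
    same datum as the weight \<open>k\<close> of the smaller pair together with both
    summands.\<close>
  also have "\<dots> = (\<Sum>(k, ij, ij')\<in>(SIGMA k:{..m}. ?T k \<times> ?T (m - k)).
       (coeff2 A (fst ij) (snd ij) * x ^ snd ij) * (coeff2 B (fst ij') (snd ij') * x ^ snd ij'))"
    by (rule sum.reindex_bij_witness[of _
          "\<lambda>(k, (i, j), (i', j')). ((i + i', j + j'), (i, j))"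
          "\<lambda>((p, q), (i, j)). (i + r * j, (i, j), (p - i, q - j))"])
      (auto simp: algebra_simps simp flip: power_add intro: add_mono mult_le_mono2)
  also have "\<dots> = (\<Sum>k\<le>m. \<Sum>(ij, ij')\<in>?T k \<times> ?T (m - k).
       (coeff2 A (fst ij) (snd ij) * x ^ snd ij) * (coeff2 B (fst ij') (snd ij') * x ^ snd ij'))"
    by (rule sum.Sigma[symmetric]) (use finite_weight[OF assms] in auto)
  also have "\<dots> = fps_nth (curve r x A * curve r x B) m"
    by (simp add: curve_def fps_mult_nth atLeast0AtMost sum_product sum.cartesian_product
        case_prod_unfold)
  finally show "fps_nth (curve r x (A * B)) m = fps_nth (curve r x A * curve r x B) m" .
qed

lemma curve_power:
  assumes "r \<ge> 1"
  shows "curve r x (A ^ n) = curve r x A ^ n"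
proof (induction n)
  case 0
  show ?case
  proof (rule fps_ext)
    fix m
    have "fps_nth (curve r x 1) m = (\<Sum>pq\<in>{(p, q). p + r * q = m}. if pq = (0, 0) then 1 else 0)"
      unfolding curve_def fps_nth_Abs_fps
      by (rule sum.cong) (auto simp: coeff2_def split: if_splits)
    also have "\<dots> = fps_nth 1 m"
      using finite_weight[OF assms, of m] by auto
    finally show "fps_nth (curve r x (A ^ 0)) m = fps_nth (curve r x A ^ 0) m" by simp
  qed
qed (simp add: curve_mult[OF assms])

lemma curve_var:
  assumes "r \<ge> 1"
  shows "curve r x var1 = fps_X" "curve r x var2 = fps_const x * fps_X ^ r"
proof -
  show "curve r x var1 = fps_X"
  proof (rule fps_ext)
    fix m
    have "fps_nth (curve r x var1) m = (\<Sum>pq\<in>{(p, q). p + r * q = m}. if pq = (1, 0) then 1 else 0)"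
      unfolding curve_def fps_nth_Abs_fps
      by (rule sum.cong) (auto simp: coeff2_def split: if_splits)
    also have "\<dots> = fps_nth fps_X m"
      using finite_weight[OF assms, of m] by auto
    finally show "fps_nth (curve r x var1) m = fps_nth fps_X m" .
  qed
  show "curve r x var2 = fps_const x * fps_X ^ r"
  proof (rule fps_ext)
    fix m
    have "fps_nth (curve r x var2) m = (\<Sum>pq\<in>{(p, q). p + r * q = m}. if pq = (0, 1) then x else 0)"
      unfolding curve_def fps_nth_Abs_fps
      by (rule sum.cong) (auto simp: coeff2_def split: if_splits)
    also have "\<dots> = fps_nth (fps_const x * fps_X ^ r) m"
      using finite_weight[OF assms, of m] by (auto simp: fps_X_power_iff)
    finally show "fps_nth (curve r x var2) m = fps_nth (fps_const x * fps_X ^ r) m" .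
  qed
qed

lemma curve_nth_0:
  assumes "r \<ge> 1" shows "fps_nth (curve r x A) 0 = coeff2 A 0 0"
proof -
  have "{(p, q). p + r * q = 0} = {(0, 0::nat)}" using assms by auto
  then show ?thesis by (simp add: curve_def)
qed

lemma curve_subst2:
  assumes r: "r \<ge> 1" and 0: "coeff2 A 0 0 = 0" "coeff2 B 0 0 = 0"
  shows "curve r x (subst2 F A B) = eval2 (coeff2 F) (curve r x A) (curve r x B)"
proof (rule fps_ext)
  fix m
  let ?T = "{(p, q). p + r * q = m}" and ?S = "{..m} \<times> {..m}"
  have "fps_nth (curve r x (subst2 F A B)) m =
    (\<Sum>(p, q)\<in>?T. (\<Sum>(i, j)\<in>{(i, j). i + j \<le> p + q}. coeff2 F i j * coeff2 (A ^ i * B ^ j) p q) * x ^ q)"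
    by (simp add: curve_def subst2_def coeff2_def)
  \<comment> \<open>The triangle depends on \<open>(p, q)\<close>; a square depending only on
    \<open>m\<close> replaces it so that the sums can be exchanged. The added monomials vanish at
    \<open>(p, q)\<close>, and \<open>r \<ge> 1\<close> ensures that the square is large
    enough.\<close>
  also have "\<dots> = (\<Sum>(p, q)\<in>?T. (\<Sum>(i, j)\<in>?S. coeff2 F i j * coeff2 (A ^ i * B ^ j) p q) * x ^ q)"
  proof (intro sum.cong refl, clarify)
    fix p q assume m: "m = p + r * q"
    have "(\<Sum>(i, j)\<in>{(i, j). i + j \<le> p + q}. coeff2 F i j * coeff2 (A ^ i * B ^ j) p q) =
      (\<Sum>(i, j)\<in>{..p + r * q} \<times> {..p + r * q}. coeff2 F i j * coeff2 (A ^ i * B ^ j) p q)"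
    proof (rule sum.mono_neutral_left)
      have "q \<le> r * q" using r by simp
      then have "i \<le> p + r * q \<and> j \<le> p + r * q" if "i + j \<le> p + q" for i j
        using that by linarith
      then show "{(i, j). i + j \<le> p + q} \<subseteq> {..p + r * q} \<times> {..p + r * q}" by auto
    qed (use subst2_omitted_terms[OF 0, of p q] in \<open>(auto simp: not_le[symmetric], blast)\<close>)
    then show "(\<Sum>(i, j)\<in>{(i, j). i + j \<le> p + q}. coeff2 F i j * coeff2 (A ^ i * B ^ j) p q) * x ^ q =
      (\<Sum>(i, j)\<in>{..p + r * q} \<times> {..p + r * q}. coeff2 F i j * coeff2 (A ^ i * B ^ j) p q) * x ^ q"
      by simp
  qed
  also have "\<dots> = (\<Sum>(i, j)\<in>?S. coeff2 F i j * fps_nth (curve r x (A ^ i * B ^ j)) m)"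
    by (simp add: curve_def sum_distrib_left sum_distrib_right case_prod_unfold mult_ac)
      (rule sum.swap)
  also have "\<dots> = fps_nth (eval2 (coeff2 F) (curve r x A) (curve r x B)) m"
    by (simp add: eval2_def curve_mult[OF r] curve_power[OF r] sum.cartesian_product)
  finally show "fps_nth (curve r x (subst2 F A B)) m =
    fps_nth (eval2 (coeff2 F) (curve r x A) (curve r x B)) m" .
qed

section \<open>Conjugation of series in z and zbar\<close>

lemma coeff2_conj2 [simp]: "coeff2 (conj2 A) p q = cnj (coeff2 A q p)"
  by (simp add: conj2_def coeff2_def)

lemma fps2_eqI: "(\<And>p q. coeff2 A p q = coeff2 B p q) \<Longrightarrow> A = B"
  by (intro fps_ext) (simp add: coeff2_def)

lemma conj2_mult: "conj2 (A * B) = conj2 A * conj2 B"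
proof (rule fps2_eqI)
  fix p q
  have "coeff2 (conj2 (A * B)) p q =
      (\<Sum>(i, j)\<in>{..q} \<times> {..p}. coeff2 (conj2 A) j i * coeff2 (conj2 B) (p - j) (q - i))"
    by (simp add: coeff2_mult case_prod_unfold)
  also have "\<dots> = coeff2 (conj2 A * conj2 B) p q"
    unfolding coeff2_mult by (rule sum.reindex_bij_witness[of _ prod.swap prod.swap]) auto
  finally show "coeff2 (conj2 (A * B)) p q = coeff2 (conj2 A * conj2 B) p q" .
qed

lemma conj2_power: "conj2 (A ^ n) = conj2 A ^ n"
proof (induction n)
  case 0
  show ?case by (rule fps2_eqI) (auto simp: coeff2_def conj2_def)
qed (simp add: conj2_mult)

text \<open>In contrast to \<open>conj2\<close>, the variables stay in place: this is the series
  Fbar for which the conjugate of F(z, w) is Fbar(zbar, wbar).\<close>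

definition cnj_coeffs :: "fps2 \<Rightarrow> fps2" where
  "cnj_coeffs F = Abs_fps (\<lambda>n. Abs_fps (\<lambda>m. cnj (coeff2 F m n)))"

lemma coeff2_cnj_coeffs [simp]: "coeff2 (cnj_coeffs F) m n = cnj (coeff2 F m n)"
  by (simp add: cnj_coeffs_def coeff2_def)

lemma coeff2_subst2:
  "coeff2 (subst2 F A B) m n =
    (\<Sum>(i, j)\<in>{(i, j). i + j \<le> m + n}. coeff2 F i j * coeff2 (A ^ i * B ^ j) m n)"
  by (simp add: subst2_def coeff2_def)

lemma conj2_subst2: "conj2 (subst2 F A B) = subst2 (cnj_coeffs F) (conj2 A) (conj2 B)"
  by (rule fps2_eqI)
    (simp add: coeff2_subst2 case_prod_unfold add.commute flip: conj2_power conj2_mult)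

lemma conj2_var1: "conj2 var1 = var2"
  by (rule fps2_eqI) (simp add: coeff2_def conj2_def)

lemma conj2_bishop: "conj2 (bishop s a) = bishop s a"
  by (rule fps2_eqI) (auto simp: coeff2_bishop)

lemma coeff2_var_monomial:
  "coeff2 (var1 ^ i * var2 ^ j) m n = (if i = m \<and> j = n then 1 else 0)"
  by (auto simp: coeff2_def fps_X_power_mult_right_nth fps_const_power fps_X_power_iff)

lemma subst2_var1_var2: "subst2 F var1 var2 = F"
proof (rule fps2_eqI)
  fix m n
  have "coeff2 (subst2 F var1 var2) m n =
    (\<Sum>x\<in>{(i, j). i + j \<le> m + n}. if x = (m, n) then coeff2 F m n else 0)"
    unfolding coeff2_subst2 by (rule sum.cong) (auto simp: coeff2_var_monomial simp del: fps_const_power split: if_splits)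
  also have "finite {(i, j). i + j \<le> m + n}"
    by (rule finite_subset[of _ "{..m+n} \<times> {..m+n}"]) auto
  then have "(\<Sum>x\<in>{(i, j). i + j \<le> m + n}. if x = (m, n) then coeff2 F m n else 0) = coeff2 F m n"
    by simp
  finally show "coeff2 (subst2 F var1 var2) m n = coeff2 F m n" .
qed

subsection \<open>Weighted sums and polynomial identities\<close>

lemma weight_sum:
  fixes c :: "nat \<Rightarrow> nat \<Rightarrow> complex"
  assumes "s \<ge> 1"
  shows "(\<Sum>(i, j)\<in>{(i, j). i + s * j = k}. c i j * y ^ j) = (\<Sum>j\<le>k div s. c (k - s * j) j * y ^ j)"
proof (rule sum.reindex_bij_witness[of _ "\<lambda>j. (k - s * j, j)" snd])
  fix j assume "j \<in> {..k div s}"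
  then have "s * j \<le> k"
    using assms by (simp add: less_eq_div_iff_mult_less_eq mult.commute)
  then show "(k - s * j, j) \<in> {(i, j). i + s * j = k}" by simp
next
  fix ij assume "ij \<in> {(i, j). i + s * j = k}"
  then obtain i j where "ij = (i, j)" "i + s * j = k" by auto
  moreover from this have "j * s \<le> k" by (simp add: mult.commute flip: \<open>i + s * j = k\<close>)
  ultimately show "snd ij \<in> {..k div s}" "(k - s * snd ij, snd ij) = ij"
    "c (k - s * snd ij) (snd ij) * y ^ snd ij = (case ij of (i, j) \<Rightarrow> c i j * y ^ j)"
    using assms by (auto simp: less_eq_div_iff_mult_less_eq)
qed simp

text \<open>The case \<open>i = 0\<close> forces \<open>s dvd k\<close> and \<open>i = 1\<close>
  forces \<open>s dvd Suc k\<close>, with \<open>j\<close> then determined, so at most one monomial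
  of each kind survives.\<close>

lemma weight_sum_conj:
  fixes c :: "nat \<Rightarrow> nat \<Rightarrow> complex"
  assumes "s \<ge> 2" and c: "\<And>i j. (s - 1) * i + s * j = k \<Longrightarrow> i \<ge> 2 \<Longrightarrow> c i j = 0"
  shows "(\<Sum>(i, j)\<in>{(i, j). (s - 1) * i + s * j = k}. c i j * (x ^ i * y ^ j)) =
    (if s dvd k then c 0 (k div s) * y ^ (k div s) else 0) +
    (if s dvd Suc k then c 1 (Suc k div s - 1) * x * y ^ (Suc k div s - 1) else 0)"
proof -
  let ?W = "{(i, j). (s - 1) * i + s * j = k}" and ?f = "\<lambda>(i, j). c i j * (x ^ i * y ^ j)"
  have W0: "{ij \<in> ?W. fst ij = 0} = (if s dvd k then {(0, k div s)} else {})"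
  proof (cases "s dvd k")
    case False
    have "{ij \<in> ?W. fst ij = 0} = {}"
    proof (rule equals0I)
      fix ij assume "ij \<in> {ij \<in> ?W. fst ij = 0}"
      then have "s dvd k" by auto
      with False show False by simp
    qed
    then show ?thesis using False by simp
  qed (use assms(1) in auto)
  have 1: "s - 1 + s * j = k \<longleftrightarrow> s * Suc j = Suc k" for j
    using assms(1) by auto
  have W1: "{ij \<in> ?W. fst ij = 1} = (if s dvd Suc k then {(1, Suc k div s - 1)} else {})"
  proof -
    have "{ij \<in> ?W. fst ij = 1} = {1} \<times> {j. s - 1 + s * j = k}" by auto
    also have "{j. s - 1 + s * j = k} = (if s dvd Suc k then {Suc k div s - 1} else {})"
    proof (cases "s dvd Suc k")
      case True
      define l where "l = Suc k div s"
      have l: "s * l = Suc k" using True by (simp add: l_def)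
      then have "l \<noteq> 0" by (metis mult_0_right nat.distinct(1))
      have iff: "s * Suc j = s * l \<longleftrightarrow> Suc j = l" for j
        using assms(1) by (simp del: mult_Suc_right)
      have "s * Suc j = s * l \<longleftrightarrow> j = l - 1" for j
        unfolding iff using \<open>l \<noteq> 0\<close> by auto
      then show ?thesis using True assms(1) unfolding 1 l[symmetric] l_def[symmetric] by simp
    next
      case False
      then have "s * Suc j \<noteq> Suc k" for j by (metis dvd_triv_left)
      then show ?thesis using False unfolding 1 by simp
    qed
    finally show ?thesis by simp
  qed
  have "i \<le> k \<and> j \<le> k" if "(s - 1) * i + s * j = k" for i j
  proof -
    have "1 * i \<le> (s - 1) * i" "1 * j \<le> s * j" using assms(1) by (intro mult_le_mono1; simp)+
    then show ?thesis using that by linarith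
  qed
  then have "finite ?W"
    by (intro finite_subset[of ?W "{..k} \<times> {..k}"]) auto
  moreover have "?f ij = 0" if "ij \<in> ?W - ({ij \<in> ?W. fst ij = 0} \<union> {ij \<in> ?W. fst ij = 1})" for ij
  proof -
    obtain i j where ij: "ij = (i, j)" by (cases ij)
    with that have "(s - 1) * i + s * j = k" "i \<noteq> 0" "i \<noteq> 1" by auto
    then show ?thesis using c[of i j] ij by simp
  qed
  ultimately have "sum ?f ?W = sum ?f ({ij \<in> ?W. fst ij = 0} \<union> {ij \<in> ?W. fst ij = 1})"
    by (intro sum.mono_neutral_right ballI) blast+
  also have "\<dots> = sum ?f {ij \<in> ?W. fst ij = 0} + sum ?f {ij \<in> ?W. fst ij = 1}"
    using \<open>finite ?W\<close> by (intro sum.union_disjoint) auto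
  finally show ?thesis unfolding W0 W1 by (auto simp: mult_ac)
qed

text \<open>At the root \<open>- c\<close> only the term with \<open>b\<close> remains, so
  \<open>b = 0\<close>; then the linear factor cancels because polynomials form an integral
  domain.\<close>

lemma polyfun_linear_factor:
  fixes p :: "nat \<Rightarrow> complex"
  assumes "\<And>y. (y + c) * (\<Sum>j\<le>J. p j * y ^ j) + b * y ^ K = 0" and "c \<noteq> 0"
  shows "b = 0" "\<And>j. j \<le> J \<Longrightarrow> p j = 0"
proof -
  show b: "b = 0" using assms(1)[of "- c"] \<open>c \<noteq> 0\<close> by simp
  define P where "P = (\<Sum>j\<le>J. monom (p j) j)"
  have "poly ([:c, 1:] * P) y = 0" for y
    using assms(1)[of y] b by (simp add: P_def poly_sum poly_monom algebra_simps)
  then have "[:c, 1:] * P = 0" using poly_all_0_iff_0 by blast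
  then have "P = 0" unfolding mult_eq_0_iff by simp
  moreover have "coeff P j = p j" if "j \<le> J" for j
    using that by (simp add: P_def coeff_sum)
  ultimately show "p j = 0" if "j \<le> J" for j using that by (metis coeff_0)
qed

text \<open>
  This handles the weights divisible by \<open>s\<close>, where the unknown \<open>p J\<close> also occurs conjugated.  The value at
  the zero \<open>1 - s\<close> of the linear factor and the top coefficient give two relations between
  \<open>g\<close> and \<open>p J\<close>, incompatible unless both vanish because \<open>s \<noteq> 2\<close>.
\<close>

lemma polyfun_resonance:
  fixes p :: "nat \<Rightarrow> complex" and s :: nat
  assumes eq: "\<And>y. g * y ^ Suc J =
      (y + (of_nat s - 1)) * (\<Sum>j\<le>J. p j * y ^ j) + cnj (p J) * (y - 1) * y ^ J"
    and s: "s \<ge> 3"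
  shows "g = 0" "\<And>j. j \<le> J \<Longrightarrow> p j = 0"
proof -
  define c where "c = (of_nat s - 1 :: complex)"
  define e where "e = cnj (p J)"
  have c0: "c \<noteq> 0" "cnj c = c" using s by (auto simp: c_def)
  define P where "P = (\<Sum>j\<le>J. monom (p j) j)"
  have "poly (monom g (Suc J)) y = poly ([:c, 1:] * P + monom e (Suc J) - monom e J) y" for y
    using eq[of y] by (simp add: P_def poly_sum poly_monom c_def e_def algebra_simps)
  then have "monom g (Suc J) = [:c, 1:] * P + monom e (Suc J) - monom e J"
    by (metis poly_eq_poly_eq_iff ext)
  then have "coeff (monom g (Suc J)) (Suc J) = coeff ([:c, 1:] * P + monom e (Suc J) - monom e J) (Suc J)"
    by simp
  moreover have "coeff P J = p J" "coeff P (Suc J) = 0" by (simp_all add: P_def coeff_sum)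
  ultimately have top: "g = p J + e" by simp
  have "g * (- c) ^ Suc J = e * (- c - 1) * (- c) ^ J"
    using eq[of "- c"] by (simp add: c_def e_def)
  then have "(g * c) * (- c) ^ J = (e * (c + 1)) * (- c) ^ J" by (simp add: algebra_simps)
  then have root: "g * c = e * (c + 1)" using c0 by simp
  \<comment> \<open>\<open>g\<close> is \<open>p J\<close> plus its conjugate, hence real.
    Conjugating the relation \<open>root\<close> and adding the two gives
    \<open>2 g c = g (c + 1)\<close>, where \<open>c - 1 = s - 2\<close> is nonzero.\<close>
  have "cnj g = g" using top by (simp add: e_def)
  then have "g * c = p J * (c + 1)" using arg_cong[OF root, of cnj] c0 by (simp add: e_def)
  then have "g * c + g * c = g * (c + 1)" using root top by (simp add: algebra_simps)
  then have "g * (c - 1) = 0" by (simp add: algebra_simps)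
  moreover have "c - 1 = of_nat (s - 2)" using s by (simp add: c_def of_nat_diff)
  then have "c - 1 \<noteq> 0" unfolding \<open>c - 1 = of_nat (s - 2)\<close> of_nat_eq_0_iff using s by simp
  ultimately show g: "g = 0" by simp
  have "c + 1 \<noteq> 0" using s by (simp add: c_def)
  then have "e = 0" using root g by simp
  then have "(y + c) * (\<Sum>j\<le>J. p j * y ^ j) + 0 * y ^ 0 = 0" for y
    using eq[of y] g unfolding c_def e_def by simp
  then show "p j = 0" if "j \<le> J" for j
    using polyfun_linear_factor(2) c0(1) that by blast
qed

section \<open>The Bishop series on the curves\<close>

lemma exponents_gt: "n \<in> exponents s \<Longrightarrow> s < n"
proof -
  assume "n \<in> exponents s"
  then obtain k j where "n = k * s + j" "k \<ge> 1" "j \<ge> 2" by (auto simp: exponents_def)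
  moreover from this have "s \<le> k * s" by simp
  ultimately show "s < n" by linarith
qed

lemma exponents_mod: "n \<in> exponents s \<Longrightarrow> n mod s \<ge> 2"
  by (auto simp: exponents_def)

lemma bishop_coeff_less: "n < s \<Longrightarrow> bishop_coeff s a n = 0"
  using exponents_gt[of n s] by (auto simp: bishop_coeff_def)

lemma bishop_coeff_self [simp]: "bishop_coeff s a s = 1"
  using exponents_gt[of s s] by (auto simp: bishop_coeff_def)

lemma curve_bishop_nth:
  assumes "s \<ge> 2" "m \<ge> 1"
  shows "fps_nth (curve (s - 1) x (bishop s a)) m = fps_nth (fps_X * (fps_const x * fps_X ^ (s - 1))) m
    + (\<Sum>n\<le>m. bishop_coeff s a n * fps_nth (fps_X ^ n) m)
    + (\<Sum>n\<le>m. cnj (bishop_coeff s a n) * fps_nth ((fps_const x * fps_X ^ (s - 1)) ^ n) m)"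
proof -
  have r: "s - 1 \<ge> 1" using assms by simp
  have "curve (s - 1) x (bishop s a) = eval2 (coeff2 (bishop s a)) fps_X (fps_const x * fps_X ^ (s - 1))"
    using curve_subst2[OF r, of var1 var2 x "bishop s a"]
    unfolding subst2_var1_var2 curve_var[OF r] by (simp add: coeff2_def)
  then show ?thesis using eval2_bishop_nth[of fps_X "fps_const x * fps_X ^ (s - 1)" m s a] assms by simp
qed

text \<open>On the curve both \<open>z zbar\<close> and \<open>z^s\<close> have order
  \<open>s\<close>, contributing \<open>x\<close> and \<open>1\<close>, while \<open>zbar^s\<close>
  has order \<open>s (s - 1) > s\<close>. This balance motivates the weight \<open>s - 1\<close> of
  zbar.\<close>

lemma curve_bishop_leading:
  assumes "s \<ge> 3"
  shows "fps_X ^ s dvd curve (s - 1) x (bishop s a)"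
    "fps_nth (curve (s - 1) x (bishop s a)) s = 1 + x"
proof -
  let ?H = "curve (s - 1) x (bishop s a)"
  have *: "fps_nth ?H m = (if m = s then 1 + x else 0)" if "1 \<le> m" "m \<le> s" for m
  proof -
    have "bishop_coeff s a n * fps_nth (fps_X ^ n) m = (if n = m then if m = s then 1 else 0 else 0)"
      if "n \<le> m" for n
      using \<open>m \<le> s\<close> that bishop_coeff_less[of n s a] by (cases "n = s") (auto simp: fps_X_power_iff)
    then have 1: "(\<Sum>n\<le>m. bishop_coeff s a n * fps_nth (fps_X ^ n) m) = (\<Sum>n\<le>m. if n = m then if m = s then 1 else 0 else 0)"
      by (intro sum.cong refl) simp
    have "cnj (bishop_coeff s a n) * fps_nth ((fps_const x * fps_X ^ (s - 1)) ^ n) m = 0"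
      if "n \<le> m" for n
    proof (cases "n = s")
      case True
      have "s * 2 \<le> s * (s - 1)" using assms by (intro mult_le_mono2) simp
      then have "m < s * (s - 1)" using \<open>m \<le> s\<close> assms by linarith
      then have "m < (s - 1) * n" using True by (simp add: mult.commute)
      moreover have "fps_X ^ ((s - 1) * n) dvd (fps_const x * fps_X ^ (s - 1)) ^ n"
        by (rule fps_power_leading) simp
      ultimately show ?thesis by (simp add: fps_X_power_dvd_nth)
    qed (use \<open>m \<le> s\<close> that bishop_coeff_less in auto)
    then have 2: "(\<Sum>n\<le>m. cnj (bishop_coeff s a n) * fps_nth ((fps_const x * fps_X ^ (s - 1)) ^ n) m) = 0"
      by (intro sum.neutral) auto
    have mon: "fps_X * (fps_const x * fps_X ^ (s - 1)) = fps_const x * fps_X ^ s"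
      using power_minus_mult[of s "fps_X :: complex fps"] assms by (simp add: mult_ac)
    have "fps_nth (fps_X * (fps_const x * fps_X ^ (s - 1))) m = (if m = s then x else 0)"
      unfolding mon by (simp add: fps_X_power_iff)
    moreover have "s \<ge> 2" using assms by simp
    ultimately show ?thesis
      unfolding curve_bishop_nth[OF \<open>s \<ge> 2\<close> that(1)] 1 2 by simp
  qed
  have "fps_nth ?H 0 = 0"
    using assms exponents_gt[of 0 s] by (auto simp: curve_nth_0 coeff2_bishop)
  then have "fps_nth ?H i = 0" if "i < s" for i
    using *[of i] that by (cases "i = 0") auto
  then show "fps_X ^ s dvd ?H" by (simp add: fps_X_power_dvd_iff)
  show "fps_nth ?H s = 1 + x" using * assms by simp
qed

lemma subst2_swap: "subst2 F A B = subst2 (Abs_fps (\<lambda>n. Abs_fps (\<lambda>m. coeff2 F n m))) B A"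
proof (rule fps2_eqI)
  fix p q
  show "coeff2 (subst2 F A B) p q =
      coeff2 (subst2 (Abs_fps (\<lambda>n. Abs_fps (\<lambda>m. coeff2 F n m))) B A) p q"
    unfolding coeff2_subst2
    by (rule sum.reindex_bij_witness[of _ prod.swap prod.swap])
      (auto simp: coeff2_def mult.commute)
qed

text \<open>Conjugation exchanges the two arguments and conjugates the coefficients of the outer
  series; a Bishop series is invariant under the combination of transposition and
  conjugation.\<close>

lemma conj2_subst2_bishop:
  "conj2 (subst2 (bishop s a) A (conj2 A)) = subst2 (bishop s a) A (conj2 A)"
proof -
  have "conj2 (conj2 A) = A" by (rule fps2_eqI) simp
  moreover have "Abs_fps (\<lambda>n. Abs_fps (\<lambda>m. coeff2 (cnj_coeffs (bishop s a)) n m)) = bishop s a"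
    by (rule fps2_eqI) (auto simp: coeff2_bishop coeff2_def[of "Abs_fps _"])
  ultimately show ?thesis
    by (simp add: conj2_subst2 subst2_swap[of "cnj_coeffs (bishop s a)"])
qed

subsection \<open>Equivalences of Bishop surfaces\<close>

locale bishop_equivalence =
  fixes s :: nat and a a' :: "nat \<Rightarrow> complex" and F1 F2 :: fps2
  assumes s: "s \<ge> 3"
    and transformation: "formal_transformation F1 F2"
    and maps: "maps_surface F1 F2 (bishop s a) (bishop s a')"
begin

abbreviation z :: "complex fps" where "z \<equiv> fps_X"
definition \<zeta> :: "complex \<Rightarrow> complex fps" where "\<zeta> x = fps_const x * fps_X ^ (s - 1)"

definition w :: "complex \<Rightarrow> complex fps" where "w x = curve (s - 1) x (bishop s a)"

lemma s1: "s - 1 \<ge> 1" using s by simp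

lemma w_leading: "fps_X ^ s dvd w x" "fps_nth (w x) s = 1 + x"
  using curve_bishop_leading[OF s] by (simp_all add: w_def)

lemma bishop_0: "coeff2 (bishop s a) 0 0 = 0"
  using s exponents_gt[of 0 s] by (auto simp: coeff2_bishop)

lemma nth_0: "fps_nth z 0 = 0" "fps_nth (\<zeta> x) 0 = 0" "fps_nth (w x) 0 = 0"
  using s bishop_0 curve_nth_0[OF s1] by (simp_all add: w_def \<zeta>_def)

lemma curve_holomorphic: "curve (s - 1) x (subst2 F var1 (bishop s a)) = eval2 (coeff2 F) z (w x)"
  using curve_subst2[OF s1, of var1 "bishop s a" x F] bishop_0
  unfolding curve_var[OF s1] by (simp add: w_def coeff2_def)

text \<open>The series of the surface is real, so conjugation turns z into zbar but leaves w
  unchanged: the same \<open>w x\<close> occurs in both restrictions.\<close>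

lemma curve_antiholomorphic:
  "curve (s - 1) x (conj2 (subst2 F var1 (bishop s a))) =
     eval2 (\<lambda>i j. cnj (coeff2 F i j)) (\<zeta> x) (w x)"
proof -
  have "coeff2 (cnj_coeffs F) = (\<lambda>i j. cnj (coeff2 F i j))" by (intro ext) simp
  moreover have "coeff2 var2 0 0 = 0" by (simp add: coeff2_def)
  ultimately show ?thesis
    using curve_subst2[OF s1, of var2 "bishop s a" x "cnj_coeffs F"] bishop_0
    unfolding curve_var[OF s1] by (simp only: conj2_subst2 conj2_var1 conj2_bishop w_def \<zeta>_def)
qed

lemma eval2_z_leading:
  assumes "\<And>i j. i + s * j < k \<Longrightarrow> c i j = 0"
  shows "fps_X ^ k dvd eval2 c z (w x)"
    "fps_nth (eval2 c z (w x)) k = (\<Sum>j\<le>k div s. c (k - s * j) j * (1 + x) ^ j)"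
  using eval2_leading[of 1 z s "w x" k c] assms s w_leading
  by (simp_all add: weight_sum)

lemma eval2_zeta_leading:
  assumes "\<And>i j. (s - 1) * i + s * j < k \<Longrightarrow> c i j = 0"
    and "\<And>i j. (s - 1) * i + s * j = k \<Longrightarrow> i \<ge> 2 \<Longrightarrow> c i j = 0"
  shows "fps_X ^ k dvd eval2 c (\<zeta> x) (w x)"
    "fps_nth (eval2 c (\<zeta> x) (w x)) k =
      (if s dvd k then c 0 (k div s) * (1 + x) ^ (k div s) else 0) +
      (if s dvd Suc k then c 1 (Suc k div s - 1) * x * (1 + x) ^ (Suc k div s - 1) else 0)"
proof -
  have "fps_X ^ (s - 1) dvd \<zeta> x" by (simp add: \<zeta>_def)
  note lead = eval2_leading[OF this w_leading(1)[of x] s1, of k c]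
  show "fps_X ^ k dvd eval2 c (\<zeta> x) (w x)" using lead(1) assms(1) s by simp
  have "fps_nth (\<zeta> x) (s - 1) = x" by (simp add: \<zeta>_def)
  then have "fps_nth (eval2 c (\<zeta> x) (w x)) k =
      (\<Sum>(i, j)\<in>{(i, j). (s - 1) * i + s * j = k}. c i j * (x ^ i * (1 + x) ^ j))"
    using lead(2) assms(1) s w_leading(2) by simp
  also have "\<dots> = (if s dvd k then c 0 (k div s) * (1 + x) ^ (k div s) else 0) +
      (if s dvd Suc k then c 1 (Suc k div s - 1) * x * (1 + x) ^ (Suc k div s - 1) else 0)"
    by (rule weight_sum_conj) (use s assms(2) in auto)
  finally show "fps_nth (eval2 c (\<zeta> x) (w x)) k =
      (if s dvd k then c 0 (k div s) * (1 + x) ^ (k div s) else 0) +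
      (if s dvd Suc k then c 1 (Suc k div s - 1) * x * (1 + x) ^ (Suc k div s - 1) else 0)" .
qed

section \<open>The mapping equation and the reality of F2\<close>

abbreviation f :: "complex \<Rightarrow> complex fps" where "f x \<equiv> eval2 (coeff2 F1) z (w x)"
abbreviation fbar :: "complex \<Rightarrow> complex fps" where
  "fbar x \<equiv> eval2 (\<lambda>i j. cnj (coeff2 F1 i j)) (\<zeta> x) (w x)"
abbreviation g :: "complex \<Rightarrow> complex fps" where "g x \<equiv> eval2 (coeff2 F2) z (w x)"

lemma F_0: "coeff2 F1 0 0 = 0" "coeff2 F2 0 0 = 0"
  using transformation by (simp_all add: formal_transformation_def)

lemma equation: "g x = eval2 (coeff2 (bishop s a')) (f x) (fbar x)"
proof -
  let ?A = "subst2 F1 var1 (bishop s a)"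
  have "coeff2 ?A 0 0 = 0" using F_0 by (simp add: coeff2_subst2)
  moreover from this have "coeff2 (conj2 ?A) 0 0 = 0" by simp
  ultimately show ?thesis
    using maps curve_subst2[OF s1, of ?A "conj2 ?A" x "bishop s a'"]
    by (simp only: maps_surface_def flip: curve_holomorphic curve_antiholomorphic)
qed

lemma g_real: "g x = eval2 (\<lambda>i j. cnj (coeff2 F2 i j)) (\<zeta> x) (w x)"
proof -
  have "conj2 (subst2 F2 var1 (bishop s a)) = subst2 F2 var1 (bishop s a)"
    using maps by (simp add: maps_surface_def conj2_subst2_bishop)
  then show ?thesis by (metis curve_holomorphic curve_antiholomorphic)
qed

text \<open>Replacing z by zbar strictly raises the weight of a monomial that contains z. This makes
  the induction in \<open>F2_weight\<close> work.\<close>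

lemma weight_less: "i > 0 \<Longrightarrow> i + s * j < (s - 1) * i + s * j"
proof -
  assume "i > 0"
  then have "1 * i < (s - 1) * i" using s by (intro mult_strict_right_mono) auto
  then show ?thesis by simp
qed

text \<open>Induction on the weight \<open>d\<close>. By hypothesis the part \<open>v\<close> of
  lower weight is a real series in w, which is equal on both sides of \<open>g_real\<close> and
  cancels. At order \<open>d\<close> a monomial containing zbar carries a coefficient that already
  vanishes by \<open>weight_less\<close>, so the conjugate side retains at most a pure power of w,
  and comparing polynomials in \<open>y = 1 + x\<close> determines all coefficients of weight
  \<open>d\<close>.\<close>

lemma F2_weight:
  "i + s * j = d \<Longrightarrow>
    (i > 0 \<longrightarrow> coeff2 F2 i j = 0) \<and> (i = 0 \<longrightarrow> cnj (coeff2 F2 i j) = coeff2 F2 i j)"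
proof (induction d arbitrary: i j rule: less_induct)
  case (less d)
  define u where "u i j = (if i = 0 \<and> s * j < d then 0 else coeff2 F2 i j)" for i j
  define v where "v i j = (if i = 0 \<and> s * j < d then coeff2 F2 i j else 0)" for i j
  have u0: "u i j = 0" if "i + s * j < d" for i j
    using less.IH[OF that refl] that by (auto simp: u_def)
  have F2: "coeff2 F2 = (\<lambda>i j. u i j + v i j)" by (intro ext) (simp add: u_def v_def)
  have "cnj (v i j) = v i j" for i j using less.IH[of "s * j" 0 j] by (auto simp: v_def)
  then have "eval2 (\<lambda>i j. cnj (v i j)) (\<zeta> x) (w x) = eval2 v z (w x)" for x
    unfolding eval2_def by (intro fps_ext, unfold fps_nth_Abs_fps, intro sum.cong refl) (simp add: v_def)
  then have *: "eval2 u z (w x) = eval2 (\<lambda>i j. cnj (u i j)) (\<zeta> x) (w x)" for x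
    using g_real[of x] by (simp add: F2 eval2_add)
  have u1: "u i j = 0" if "(s - 1) * i + s * j = d" "i \<ge> 1" for i j
  proof (rule u0)
    from that have "i > 0" by simp
    from weight_less[OF this, of j] that show "i + s * j < d" by linarith
  qed
  have u2: "u i j = 0" if "(s - 1) * i + s * j < d" for i j
  proof (rule u0)
    have "1 * i \<le> (s - 1) * i" using s by (intro mult_le_mono1) simp
    then show "i + s * j < d" using that by linarith
  qed
  have right: "fps_nth (eval2 (\<lambda>i j. cnj (u i j)) (\<zeta> x) (w x)) d =
      (if s dvd d then cnj (u 0 (d div s)) * (1 + x) ^ (d div s) else 0)" for x
  proof -
    have "u 1 (Suc d div s - 1) = 0" if "s dvd Suc d"
    proof (rule u1)
      have "s * (Suc d div s) = Suc d" using that by simp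
      then show "(s - 1) * 1 + s * (Suc d div s - 1) = d"
        using s by (cases "Suc d div s") auto
    qed simp
    then show ?thesis using eval2_zeta_leading(2)[of d "\<lambda>i j. cnj (u i j)" x] u1 u2 by simp
  qed
  have "(\<Sum>j\<le>d div s. (u (d - s * j) j - (if s * j = d then cnj (u 0 j) else 0)) * y ^ j) = 0" for y
  proof -
    have "(\<Sum>j\<le>d div s. (if s * j = d then cnj (u 0 j) else 0) * y ^ j) =
        (\<Sum>j\<le>d div s. if j = d div s then (if s dvd d then cnj (u 0 j) * y ^ j else 0) else 0)"
      using s by (intro sum.cong refl) auto
    also have "\<dots> = (if s dvd d then cnj (u 0 (d div s)) * y ^ (d div s) else 0)" by simp
    finally have "(\<Sum>j\<le>d div s. (if s * j = d then cnj (u 0 j) else 0) * y ^ j) =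
        (if s dvd d then cnj (u 0 (d div s)) * y ^ (d div s) else 0)" .
    moreover obtain x where "y = 1 + x" by (metis add.commute diff_add_cancel)
    ultimately show ?thesis
      using right[of x] eval2_z_leading(2)[of d u x] u0 *[of x]
      by (cases "s dvd d") (simp_all add: left_diff_distrib sum_subtractf)
  qed
  then have **: "u (d - s * j) j = (if s * j = d then cnj (u 0 j) else 0)" if "j \<le> d div s" for j
    using Transcendental.polyfun_eq_0[where n = "d div s" and
        c = "\<lambda>j. u (d - s * j) j - (if s * j = d then cnj (u 0 j) else 0)"] that by simp
  have "j * s \<le> d" using less.prems by (simp add: mult.commute flip: less.prems)
  then have "j \<le> d div s" using s by (simp add: less_eq_div_iff_mult_less_eq)
  from **[OF this] show ?case using less.prems by (auto simp: u_def)
qed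

lemma F2_eq_0: "i > 0 \<Longrightarrow> coeff2 F2 i j = 0"
  using F2_weight by blast

section \<open>The leading coefficients of the transformation\<close>

definition \<alpha> :: complex where "\<alpha> = coeff2 F1 1 0"

text \<open>Since \<open>F2\<close> has no linear term in z, the Jacobian matrix is triangular and
  its determinant is the product of these two coefficients.\<close>

lemma leading_coeffs_nonzero: "\<alpha> \<noteq> 0" "coeff2 F2 0 1 \<noteq> 0"
proof -
  have "det (jacobian_at_0 F1 F2) \<noteq> 0"
    using transformation by (simp add: formal_transformation_def invertible_det_nz)
  then show "\<alpha> \<noteq> 0" "coeff2 F2 0 1 \<noteq> 0"
    using F2_eq_0[of 1 0] by (auto simp: jacobian_at_0_def det_2 vector_2 \<alpha>_def)
qed

lemma f_leading: "fps_X ^ 1 dvd f x" "fps_nth (f x) 1 = \<alpha>"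
proof -
  have "coeff2 F1 i j = 0" if "i + s * j < 1" for i j
    using that s F_0 by (cases j) auto
  from eval2_z_leading[of 1 "coeff2 F1", OF this] show "fps_X ^ 1 dvd f x" "fps_nth (f x) 1 = \<alpha>"
    using s by (simp_all add: \<alpha>_def)
qed

lemma fbar_leading: "fps_X ^ (s - 1) dvd fbar x" "fps_nth (fbar x) (s - 1) = cnj \<alpha> * x"
proof -
  have 1: "cnj (coeff2 F1 i j) = 0" if "(s - 1) * i + s * j < s - 1" for i j
  proof -
    have "i = 0" using that by (cases i) auto
    moreover have "j = 0" using that s by (cases j) auto
    ultimately show ?thesis using F_0 by simp
  qed
  have 2: "cnj (coeff2 F1 i j) = 0" if "(s - 1) * i + s * j = s - 1" "i \<ge> 2" for i j
  proof -
    have "(s - 1) * 2 \<le> (s - 1) * i" by (rule mult_le_mono2[OF that(2)])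
    then have False using that(1) s by linarith
    then show ?thesis ..
  qed
  have "\<not> s dvd s - 1" using s by (auto dest: dvd_imp_le)
  then show "fps_X ^ (s - 1) dvd fbar x" "fps_nth (fbar x) (s - 1) = cnj \<alpha> * x"
    using eval2_zeta_leading[OF 1 2, where x = x] s by (simp_all add: \<alpha>_def)
qed

text \<open>Comparison at weight \<open>s\<close>: on the left only w survives, since
  \<open>F2\<close> contains no power of z; on the right only the product and the
  \<open>s\<close>-th power of \<open>f x\<close> do, the \<open>s\<close>-th power of
  \<open>fbar x\<close> starting at order \<open>s (s - 1) > s\<close>.\<close>

lemma first_order:
  "coeff2 F2 0 1 * (1 + x) = \<alpha> * cnj \<alpha> * x + \<alpha> ^ s"
proof -
  have "coeff2 F2 i j = 0" if "i + s * j < s" for i j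
    using that s F_0 F2_eq_0[of i j] by (cases "i = 0"; cases j) auto
  from eval2_z_leading(2)[of s "coeff2 F2", OF this]
  have "fps_nth (g x) s = coeff2 F2 0 1 * (1 + x)"
    using s F2_eq_0[of s 0] by (simp add: numeral_eq_Suc)
  moreover have "fps_nth (f x * fbar x) s = \<alpha> * cnj \<alpha> * x"
    using fps_mult_nth_leading[OF f_leading(1) fbar_leading(1)] f_leading(2) fbar_leading(2) s
    by simp
  moreover have "(\<Sum>n\<le>s. bishop_coeff s a' n * fps_nth (f x ^ n) s) = \<alpha> ^ s"
  proof -
    have "(\<Sum>n\<le>s. bishop_coeff s a' n * fps_nth (f x ^ n) s) =
        (\<Sum>n\<le>s. if n = s then fps_nth (f x ^ s) s else 0)"
      by (intro sum.cong refl) (auto simp: bishop_coeff_less)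
    then show ?thesis using fps_power_leading(2)[OF f_leading(1)[of x], of s] f_leading(2) by simp
  qed
  moreover have "(\<Sum>n\<le>s. cnj (bishop_coeff s a' n) * fps_nth (fbar x ^ n) s) = 0"
  proof (intro sum.neutral ballI)
    fix n assume "n \<in> {..s}"
    show "cnj (bishop_coeff s a' n) * fps_nth (fbar x ^ n) s = 0"
    proof (cases "n = s")
      case True
      have "s * 2 \<le> s * (s - 1)" using s by (intro mult_le_mono2) simp
      then have "s < s * (s - 1)" using s by linarith
      then show ?thesis
        using fps_X_power_dvd_nth[OF fps_power_leading(1)[OF fbar_leading(1)[of x], of s], of s] True
        by (simp add: mult.commute)
    qed (use \<open>n \<in> {..s}\<close> in \<open>simp add: bishop_coeff_less\<close>)
  qed
  moreover have "fps_nth (f x) 0 = 0" "fps_nth (fbar x) 0 = 0"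
    using fps_X_power_dvd_nth[OF f_leading(1), of 0] fps_X_power_dvd_nth[OF fbar_leading(1), of 0] s
    by simp_all
  ultimately show ?thesis
    using eval2_bishop_nth[of "f x" "fbar x" s s a'] s equation[of x] by simp
qed

text \<open>The values of \<open>first_order\<close> at \<open>x = 0\<close> and
  \<open>x = 1\<close> identify the coefficient of w, \<open>\<alpha> ^ s\<close> and
  \<open>\<alpha> * cnj \<alpha>\<close>. Taking norms, the \<open>s\<close>-th power of
  \<open>norm \<alpha>\<close> equals its square, and \<open>s > 2\<close> forces
  \<open>norm \<alpha> = 1\<close>.\<close>

lemma leading_coeffs: "\<alpha> * cnj \<alpha> = 1" "\<alpha> ^ s = 1" "coeff2 F2 0 1 = 1"
proof -
  have d: "coeff2 F2 0 1 = \<alpha> ^ s" using first_order[of 0] by simp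
  have e: "\<alpha> ^ s = \<alpha> * cnj \<alpha>" using first_order[of 1] d by (simp add: algebra_simps)
  then have "norm \<alpha> ^ s = norm \<alpha> ^ 2"
    by (metis complex_mod_cnj norm_mult norm_power power2_eq_square)
  then have "norm \<alpha> = 1"
    using power_inject_exp'[of "norm \<alpha>" s 2] leading_coeffs_nonzero(1) s by auto
  then show "\<alpha> * cnj \<alpha> = 1" using complex_norm_square[of \<alpha>] by simp
  with d e show "\<alpha> ^ s = 1" "coeff2 F2 0 1 = 1" by simp_all
qed

section \<open>Normalization by the rotation z -> \<alpha> z\<close>

definition \<phi> :: "nat \<Rightarrow> nat \<Rightarrow> complex" where
  "\<phi> i j = cnj \<alpha> * coeff2 F1 i j - (if i = 1 \<and> j = 0 then 1 else 0)"

definition \<gamma> :: "nat \<Rightarrow> nat \<Rightarrow> complex" where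
  "\<gamma> i j = coeff2 F2 i j - (if i = 0 \<and> j = 1 then 1 else 0)"

abbreviation \<Phi> :: "complex \<Rightarrow> complex fps" where "\<Phi> x \<equiv> eval2 \<phi> z (w x)"
abbreviation \<Phi>bar :: "complex \<Rightarrow> complex fps" where
  "\<Phi>bar x \<equiv> eval2 (\<lambda>i j. cnj (\<phi> i j)) (\<zeta> x) (w x)"

text \<open>The target coefficients after the rotation is absorbed: it preserves
  \<open>z zbar\<close> and \<open>z^s\<close> and multiplies each remaining coefficient by a power
  of \<alpha>.\<close>

definition b :: "nat \<Rightarrow> complex" where "b = bishop_coeff s (\<lambda>n. a' n * \<alpha> ^ n)"

lemma cancel_\<alpha>: "\<alpha> * (cnj \<alpha> * c) = c" "cnj \<alpha> * (\<alpha> * c) = c"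
  using leading_coeffs(1) by (metis mult.assoc mult.commute mult_1)+

text \<open>\<open>cnj \<alpha>\<close> is the inverse of \<alpha>, so \<open>\<phi>\<close>
  measures how far \<open>F1\<close>, divided by \<alpha>, deviates from z.\<close>

lemma f_eq: "f x = fps_const \<alpha> * (z + \<Phi> x)"
proof -
  have "coeff2 F1 = (\<lambda>i j. \<alpha> * (\<phi> i j + (if i = 1 \<and> j = 0 then 1 else 0)))"
    by (intro ext) (simp only: \<phi>_def diff_add_cancel cancel_\<alpha>)
  then have "f x = fps_const \<alpha> * (\<Phi> x + z ^ 1 * w x ^ 0)"
    by (simp only: eval2_cmult eval2_add eval2_monomial[OF nth_0(1,3)])
  then show ?thesis by (simp add: add.commute)
qed

lemma fbar_eq: "fbar x = fps_const (cnj \<alpha>) * (\<zeta> x + \<Phi>bar x)"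
proof -
  have "cnj (\<phi> i j) + (if i = 1 \<and> j = 0 then 1 else 0) = \<alpha> * cnj (coeff2 F1 i j)" for i j
    by (simp add: \<phi>_def)
  then have "(\<lambda>i j. cnj (coeff2 F1 i j)) =
      (\<lambda>i j. cnj \<alpha> * (cnj (\<phi> i j) + (if i = 1 \<and> j = 0 then 1 else 0)))"
    by (intro ext) (simp only: cancel_\<alpha>)
  then have "fbar x = fps_const (cnj \<alpha>) * (\<Phi>bar x + \<zeta> x ^ 1 * w x ^ 0)"
    by (simp only: eval2_cmult eval2_add eval2_monomial[OF nth_0(2,3)])
  then show ?thesis by (simp add: add.commute)
qed

lemma g_eq: "g x = w x + eval2 \<gamma> z (w x)"
proof -
  have "coeff2 F2 = (\<lambda>i j. (if i = 0 \<and> j = 1 then 1 else 0) + \<gamma> i j)"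
    by (intro ext) (simp add: \<gamma>_def)
  then have "g x = z ^ 0 * w x ^ 1 + eval2 \<gamma> z (w x)"
    by (simp only: eval2_add eval2_monomial[OF nth_0(1,3)])
  then show ?thesis by simp
qed

lemma \<phi>_0: "\<phi> 0 0 = 0" "\<phi> 1 0 = 0"
  using F_0 leading_coeffs(1) by (simp_all add: \<phi>_def \<alpha>_def mult.commute)

lemma equation_nth:
  assumes "m \<ge> 1"
  shows "fps_nth (w x) m + fps_nth (eval2 \<gamma> z (w x)) m =
    fps_nth ((z + \<Phi> x) * (\<zeta> x + \<Phi>bar x)) m
    + (\<Sum>n\<le>m. b n * fps_nth ((z + \<Phi> x) ^ n) m)
    + (\<Sum>n\<le>m. cnj (b n) * fps_nth ((\<zeta> x + \<Phi>bar x) ^ n) m)"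
proof -
  have b: "bishop_coeff s a' n * \<alpha> ^ n = b n" for n
    using leading_coeffs(2) exponents_gt[of s s] by (auto simp: b_def bishop_coeff_def)
  have "f x * fbar x = fps_const (\<alpha> * cnj \<alpha>) * ((z + \<Phi> x) * (\<zeta> x + \<Phi>bar x))"
    by (simp only: f_eq fbar_eq mult_ac flip: fps_const_mult)
  then have 1: "f x * fbar x = (z + \<Phi> x) * (\<zeta> x + \<Phi>bar x)"
    by (simp add: leading_coeffs(1))
  have 2: "bishop_coeff s a' n * fps_nth (f x ^ n) m = b n * fps_nth ((z + \<Phi> x) ^ n) m" for n
    by (simp add: f_eq power_mult_distrib fps_const_power flip: b)
  have 3: "cnj (bishop_coeff s a' n) * fps_nth (fbar x ^ n) m =
      cnj (b n) * fps_nth ((\<zeta> x + \<Phi>bar x) ^ n) m" for n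
    by (simp add: fbar_eq power_mult_distrib fps_const_power flip: b)
  have "fps_nth (f x) 0 = 0" "fps_nth (fbar x) 0 = 0"
    using fps_X_power_dvd_nth[OF f_leading(1), of 0] fps_X_power_dvd_nth[OF fbar_leading(1), of 0] s
    by simp_all
  from eval2_bishop_nth[OF this assms, of s a'] show ?thesis
    unfolding 1 2 3 equation[symmetric] g_eq by simp
qed

text \<open>
  The monomial \<open>\<phi>\<^sub>i\<^sub>j z\<^sup>i w\<^sup>j\<close> of \<open>F\<^sub>1\<close> enters the equation linearly through \<open>zbar \<phi>\<close>, \<open>s z\<^sup>s\<^sup>-\<^sup>1 \<phi>\<close>
  and the conjugate term \<open>z \<phi>bar\<close>; the lowest weight of these is \<open>s - 1 + i + s j\<close> if \<open>i > 0\<close>, but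
  \<open>1 + s j\<close>, coming from the conjugate term, if \<open>i = 0\<close>.
\<close>

definition trivial_below :: "nat \<Rightarrow> bool" where
  "trivial_below m \<longleftrightarrow>
     (\<forall>i j. (if i = 0 then 1 + s * j else s - 1 + i + s * j) < m \<longrightarrow> \<phi> i j = 0) \<and>
     (\<forall>j. s * j < m \<longrightarrow> \<gamma> 0 j = 0) \<and>
     (\<forall>n\<in>exponents s. n < m \<longrightarrow> a' n * \<alpha> ^ n = a n)"

text \<open>Only \<open>\<phi> 0 0\<close>, \<open>\<phi> 1 0\<close>, \<open>\<gamma> 0 0\<close>
  and \<open>\<gamma> 0 1\<close> are concerned, all settled by the constant and leading
  coefficients; every exponent exceeds \<open>s\<close>.\<close>

lemma trivial_below_base: "trivial_below (Suc s)"
proof -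
  have "\<phi> i j = 0" if "(if i = 0 then 1 + s * j else s - 1 + i + s * j) < Suc s" for i j
  proof (cases "i = 0")
    case True
    then show ?thesis using that \<phi>_0 by (cases j) auto
  next
    case False
    then have "i + s * j < 2" using that s by simp
    then have "j = 0" using s by (cases j) auto
    then show ?thesis using False \<open>i + s * j < 2\<close> \<phi>_0 by (cases "i = 1") auto
  qed
  moreover have "\<gamma> 0 j = 0" if "s * j < Suc s" for j
  proof -
    have "s * j < s * 2" using that s by linarith
    then have "j < 2" by simp
    then show ?thesis using F_0 leading_coeffs(3) by (cases "j = 0") (auto simp: \<gamma>_def less_2_cases_iff)
  qed
  ultimately show ?thesis
    unfolding trivial_below_def using exponents_gt by fastforce
qed

text \<open>By hypothesis the corrections start so late that they enter the coefficient of order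
  \<open>m\<close> only linearly. The resulting polynomial identity \<open>main\<close> is then
  solved according to the residue of \<open>m\<close> modulo \<open>s\<close>.\<close>

lemma trivial_below_step:
  assumes triv: "trivial_below m" and m: "m > s"
  shows "trivial_below (Suc m)"
proof -
  \<comment> \<open>The order at which \<open>\<Phi> x\<close>, multiplied by zbar or by
    \<open>z^(s - 1)\<close>, first reaches order \<open>m\<close>; \<open>\<Phi>bar x\<close> is
    multiplied by z and needs order \<open>m - 1\<close>.\<close>
  define k where "k = m - (s - 1)"
  have k: "k + (s - 1) = m" "k \<ge> 2" using m s by (auto simp: k_def)
  have \<phi>: "\<phi> i j = 0" if "(if i = 0 then 1 + s * j else s - 1 + i + s * j) < m" for i j
    using triv that unfolding trivial_below_def by blast
  have \<gamma>: "\<gamma> i j = 0" if "i > 0 \<or> s * j < m" for i j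
    using triv that F2_eq_0[of i j] unfolding trivial_below_def by (cases "i = 0") (auto simp: \<gamma>_def)
  define \<delta> where "\<delta> = b m - bishop_coeff s a m"
  have b_eq: "b n = bishop_coeff s a n" if "n < m" for n
    using triv that unfolding trivial_below_def by (auto simp: b_def bishop_coeff_def)

  have \<Phi>: "fps_X ^ k dvd \<Phi> x"
      "fps_nth (\<Phi> x) k = (\<Sum>j\<le>k div s. \<phi> (k - s * j) j * (1 + x) ^ j)" for x
  proof -
    have "\<phi> i j = 0" if "i + s * j < k" for i j
      using that k s by (intro \<phi>) auto
    from eval2_z_leading[of k \<phi>, OF this] show "fps_X ^ k dvd \<Phi> x"
      "fps_nth (\<Phi> x) k = (\<Sum>j\<le>k div s. \<phi> (k - s * j) j * (1 + x) ^ j)" by auto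
  qed
  have \<Phi>bar: "fps_X ^ (m - 1) dvd \<Phi>bar x"
      "fps_nth (\<Phi>bar x) (m - 1) =
        (if s dvd m - 1 then cnj (\<phi> 0 ((m - 1) div s)) * (1 + x) ^ ((m - 1) div s) else 0) +
        (if s dvd m then cnj (\<phi> 1 (m div s - 1)) * x * (1 + x) ^ (m div s - 1) else 0)" for x
  proof -
    \<comment> \<open>For \<open>i \<ge> 1\<close> the conjugate of a monomial of
      \<open>\<phi>\<close> enters the equation no earlier than the monomial itself, and strictly
      later for \<open>i \<ge> 2\<close>. Hence only \<open>i = 0\<close> and \<open>i = 1\<close>
      remain at order \<open>m - 1\<close>.\<close>
    have le: "s - 1 + i \<le> 1 + (s - 1) * i" if "i \<ge> 1" for i
    proof -
      obtain r where "s - 1 = Suc r" using s by (cases "s - 1") auto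
      moreover obtain l where "i = Suc l" using \<open>i \<ge> 1\<close> by (cases i) auto
      ultimately show ?thesis by simp
    qed
    have less: "s - 1 + i < 1 + (s - 1) * i" if "i \<ge> 2" for i
    proof -
      have "2 \<le> s - 1" using s by simp
      then obtain r where "s - 1 = 2 + r" using le_Suc_ex by blast
      moreover obtain l where "i = 2 + l" using \<open>i \<ge> 2\<close> le_Suc_ex by blast
      ultimately show ?thesis by simp
    qed
    have 1: "cnj (\<phi> i j) = 0" if "(s - 1) * i + s * j < m - 1" for i j
      using that le[of i] by (cases "i = 0") (auto intro!: \<phi>)
    have 2: "cnj (\<phi> i j) = 0" if "(s - 1) * i + s * j = m - 1" "i \<ge> 2" for i j
      using that less[of i] m by (auto intro!: \<phi>)
    have "Suc (m - 1) = m" using m by simp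
    then show "fps_X ^ (m - 1) dvd \<Phi>bar x"
      "fps_nth (\<Phi>bar x) (m - 1) =
        (if s dvd m - 1 then cnj (\<phi> 0 ((m - 1) div s)) * (1 + x) ^ ((m - 1) div s) else 0) +
        (if s dvd m then cnj (\<phi> 1 (m div s - 1)) * x * (1 + x) ^ (m div s - 1) else 0)"
      using eval2_zeta_leading[of "m - 1" "\<lambda>i j. cnj (\<phi> i j)" x, OF 1 2] by simp_all
  qed
  have \<Gamma>: "fps_nth (eval2 \<gamma> z (w x)) m = (if s dvd m then \<gamma> 0 (m div s) * (1 + x) ^ (m div s) else 0)" for x
  proof -
    have "\<gamma> i j = 0" if "i + s * j < m" for i j using that by (intro \<gamma>) auto
    from eval2_z_leading(2)[of m \<gamma>, OF this]
    have "fps_nth (eval2 \<gamma> z (w x)) m = (\<Sum>j\<le>m div s. \<gamma> (m - s * j) j * (1 + x) ^ j)" .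
    also have "\<dots> = (\<Sum>j\<le>m div s. if j = m div s
        then (if s dvd m then \<gamma> 0 (m div s) * (1 + x) ^ (m div s) else 0) else 0)"
    proof (intro sum.cong refl)
      fix j assume "j \<in> {..m div s}"
      then have "s * j \<le> m"
        using s by (simp add: less_eq_div_iff_mult_less_eq mult.commute)
      show "\<gamma> (m - s * j) j * (1 + x) ^ j = (if j = m div s
          then (if s dvd m then \<gamma> 0 (m div s) * (1 + x) ^ (m div s) else 0) else 0)"
      proof (cases "s * j = m")
        case True
        then have "j = m div s" "s dvd m" using s by auto
        then show ?thesis using True by simp
      next
        case False
        then have "\<gamma> (m - s * j) j = 0" using \<open>s * j \<le> m\<close> by (intro \<gamma>) auto
        then show ?thesis using False by auto
      qed
    qed
    finally show ?thesis by simp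
  qed

  have prod: "fps_nth ((z + \<Phi> x) * (\<zeta> x + \<Phi>bar x)) m =
      fps_nth (z * \<zeta> x) m + x * fps_nth (\<Phi> x) k + fps_nth (\<Phi>bar x) (m - 1)" for x
  proof -
    have "fps_X ^ (s - 1) dvd \<zeta> x" "fps_nth (\<zeta> x) (s - 1) = x" by (simp_all add: \<zeta>_def)
    then have "fps_nth (\<Phi> x * \<zeta> x) m = x * fps_nth (\<Phi> x) k"
      using fps_mult_nth_leading[OF \<Phi>(1)[of x]] k by fastforce
    moreover have "fps_nth (z * \<Phi>bar x) m = fps_nth (\<Phi>bar x) (m - 1)" using m by simp
    \<comment> \<open>The quadratic term starts at order \<open>k + (m - 1)\<close>, which exceeds
      \<open>m\<close> because \<open>k \<ge> 2\<close>.\<close>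
    moreover have "fps_nth (\<Phi> x * \<Phi>bar x) m = 0"
    proof (rule fps_X_power_dvd_nth)
      show "fps_X ^ (k + (m - 1)) dvd \<Phi> x * \<Phi>bar x"
        unfolding power_add by (intro mult_dvd_mono \<Phi> \<Phi>bar)
    qed (use k m in linarith)
    ultimately show ?thesis by (simp add: algebra_simps)
  qed
  \<comment> \<open>Only the power \<open>n = s\<close> feels the perturbation to first order, since
    for \<open>n > s\<close> it starts at order \<open>k + n - 1 > m\<close>. The power
    \<open>n = m\<close> contributes the discrepancy \<open>\<delta>\<close> of the
    coefficients.\<close>
  have sum1: "(\<Sum>n\<le>m. b n * fps_nth ((z + \<Phi> x) ^ n) m) =
      (\<Sum>n\<le>m. bishop_coeff s a n * fps_nth (z ^ n) m) + of_nat s * fps_nth (\<Phi> x) k + \<delta>" for x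
  proof -
    have z: "fps_X ^ 1 dvd z" "1 < k" using k by simp_all
    have "b n * fps_nth ((z + \<Phi> x) ^ n) m = bishop_coeff s a n * fps_nth (z ^ n) m +
        ((if n = s then of_nat s * fps_nth (\<Phi> x) k else 0) + (if n = m then \<delta> else 0))"
      if "n \<le> m" for n
    proof -
      consider "n < s" | "n = s" | "n > s" by linarith
      then show ?thesis
      proof cases
        case 1
        then show ?thesis using b_eq[of n] m by (simp add: bishop_coeff_less)
      next
        case 2
        have "Suc (s - 1) = s" "k + (s - 1) * 1 = m" using k s by auto
        then have "fps_nth ((z + \<Phi> x) ^ s - z ^ s) m = of_nat s * fps_nth (\<Phi> x) k"
          using power_perturbation(2)[OF z(1) \<Phi>(1)[of x] z(2), of "s - 1"] by simp
        then show ?thesis using 2 m b_eq[of s] by (simp add: algebra_simps)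
      next
        case 3
        then have "Suc (n - 1) = n" by simp
        then have "fps_X ^ (k + (n - 1) * 1) dvd (z + \<Phi> x) ^ n - z ^ n"
          using power_perturbation(1)[OF z(1) \<Phi>(1)[of x], of "n - 1"] z(2) by simp
        then have "fps_nth ((z + \<Phi> x) ^ n - z ^ n) m = 0"
          by (rule fps_X_power_dvd_nth) (use 3 k s in linarith)
        then have "fps_nth ((z + \<Phi> x) ^ n) m = fps_nth (z ^ n) m" by simp
        then show ?thesis using b_eq[of n] that 3 by (cases "n = m") (auto simp: \<delta>_def fps_X_power_iff)
      qed
    qed
    then have "(\<Sum>n\<le>m. b n * fps_nth ((z + \<Phi> x) ^ n) m) =
        (\<Sum>n\<le>m. bishop_coeff s a n * fps_nth (z ^ n) m +
        ((if n = s then of_nat s * fps_nth (\<Phi> x) k else 0) + (if n = m then \<delta> else 0)))"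
      by (intro sum.cong refl) simp
    then show ?thesis using m by (simp add: sum.distrib)
  qed
  \<comment> \<open>Powers of zbar feel nothing at order \<open>m\<close>: for
    \<open>n \<ge> s\<close> the perturbation starts too late, and the possibly different
    coefficient at \<open>n = m\<close> multiplies a series of order
    \<open>(s - 1) * m > m\<close>.\<close>
  have sum2: "(\<Sum>n\<le>m. cnj (b n) * fps_nth ((\<zeta> x + \<Phi>bar x) ^ n) m) =
      (\<Sum>n\<le>m. cnj (bishop_coeff s a n) * fps_nth (\<zeta> x ^ n) m)" for x
  proof (intro sum.cong refl)
    fix n assume "n \<in> {..m}"
    have \<zeta>: "fps_X ^ (s - 1) dvd \<zeta> x" by (simp add: \<zeta>_def)
    show "cnj (b n) * fps_nth ((\<zeta> x + \<Phi>bar x) ^ n) m =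
        cnj (bishop_coeff s a n) * fps_nth (\<zeta> x ^ n) m"
    proof (cases "n < s")
      case True
      then show ?thesis using b_eq[of n] m by (simp add: bishop_coeff_less)
    next
      case False
      then have n: "Suc (n - 1) = n" using s by simp
      have le: "s - 1 \<le> m - 1" using m by simp
      have "2 * 2 \<le> (n - 1) * (s - 1)" using False s by (intro mult_le_mono) auto
      then have "m < m - 1 + (n - 1) * (s - 1)" using m by linarith
      then have "fps_nth ((\<zeta> x + \<Phi>bar x) ^ n - \<zeta> x ^ n) m = 0"
        using fps_X_power_dvd_nth[OF power_perturbation(1)[OF \<zeta> \<Phi>bar(1) le, of "n - 1"]]
        unfolding n by simp
      then have eq: "fps_nth ((\<zeta> x + \<Phi>bar x) ^ n) m = fps_nth (\<zeta> x ^ n) m" by simp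
      show ?thesis
      proof (cases "n = m")
        case True
        have "1 * m < (s - 1) * m" using s m by (intro mult_strict_right_mono) auto
        then have "fps_nth (\<zeta> x ^ n) m = 0"
          using fps_X_power_dvd_nth[OF fps_power_leading(1)[OF \<zeta>, of n], of m] True by simp
        then show ?thesis using eq by simp
      next
        case False
        then show ?thesis using eq b_eq[of n] \<open>n \<in> {..m}\<close> by simp
      qed
    qed
  qed

  \<comment> \<open>The terms of the source surface cancel. The contributions of
    \<open>\<Phi> x\<close> carry the factor \<open>x + s\<close>, which is
    \<open>y + (s - 1)\<close> in the variable \<open>y = 1 + x\<close>.\<close>
  have main: "(if s dvd m then \<gamma> 0 (m div s) * y ^ (m div s) else 0) =
      (y + (of_nat s - 1)) * (\<Sum>j\<le>k div s. \<phi> (k - s * j) j * y ^ j) +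
      ((if s dvd m - 1 then cnj (\<phi> 0 ((m - 1) div s)) * y ^ ((m - 1) div s) else 0) +
       (if s dvd m then cnj (\<phi> 1 (m div s - 1)) * (y - 1) * y ^ (m div s - 1) else 0)) + \<delta>" for y
  proof -
    obtain x where y: "y = 1 + x" by (metis add.commute diff_add_cancel)
    have "s \<ge> 2" "m \<ge> 1" using s m by auto
    have "fps_nth (eval2 \<gamma> z (w x)) m =
        x * fps_nth (\<Phi> x) k + fps_nth (\<Phi>bar x) (m - 1) + of_nat s * fps_nth (\<Phi> x) k + \<delta>"
      using equation_nth[OF \<open>m \<ge> 1\<close>, of x] curve_bishop_nth[OF \<open>s \<ge> 2\<close> \<open>m \<ge> 1\<close>, of x a]
      unfolding prod sum1 sum2 by (simp add: w_def \<zeta>_def)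
    then show ?thesis
      unfolding \<Gamma> \<Phi>(2) \<Phi>bar(2) y by (simp add: algebra_simps)
  qed

  have \<delta>: "\<delta> = (if m \<in> exponents s then a' m * \<alpha> ^ m - a m else 0)"
    using m by (simp add: \<delta>_def b_def bishop_coeff_def)
  have s_neq: "of_nat s - 1 \<noteq> (0::complex)" using s by auto
  have kj: "\<delta> = 0 \<and> (\<forall>j\<le>k div s. \<phi> (k - s * j) j = 0) \<and>
      (s dvd m - 1 \<longrightarrow> \<phi> 0 ((m - 1) div s) = 0) \<and> (s dvd m \<longrightarrow> \<gamma> 0 (m div s) = 0)"
  proof (cases "s dvd m")
    case True
    then obtain K where K: "m = s * K" by blast
    then have "K > 0" using m by (cases K) auto
    then obtain J where J: "K = Suc J" by (cases K) auto
    \<comment> \<open>The top coefficient in the sum is thus \<open>\<phi> 1 J\<close>, the very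
      unknown that also occurs conjugated, as \<open>polyfun_resonance\<close> requires.\<close>
    have kJ: "k = 1 + s * J" using k(1) s unfolding K J by simp
    have "k div s = J" unfolding kJ using s by (subst div_mult_self2) auto
    \<comment> \<open>Exponents have residue at least 2 modulo \<open>s\<close>, so the discrepancy
      vanishes in this case.\<close>
    have "m \<notin> exponents s" using exponents_mod[of m s] True by auto
    then have "\<delta> = 0" by (simp add: \<delta>)
    have nd: "\<not> s dvd m - 1"
    proof
      assume "s dvd m - 1"
      then have "s dvd m - (m - 1)" using True by (rule dvd_diff_nat[rotated])
      then show False using m s by simp
    qed
    have "m div s = Suc J" using s by (simp add: K J)
    have "\<gamma> 0 (Suc J) * y ^ Suc J = (y + (of_nat s - 1)) * (\<Sum>j\<le>J. \<phi> (k - s * j) j * y ^ j) +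
        cnj (\<phi> (k - s * J) J) * (y - 1) * y ^ J" for y
      using main[of y] True nd \<open>\<delta> = 0\<close> \<open>k div s = J\<close> \<open>m div s = Suc J\<close> kJ by simp
    from polyfun_resonance[OF this s]
    show ?thesis using \<open>\<delta> = 0\<close> nd \<open>k div s = J\<close> \<open>m div s = Suc J\<close> by auto
  next
    case False
    show ?thesis
    proof (cases "s dvd m - 1")
      case True
      have "m mod s < 2"
      proof -
        obtain K where "m - 1 = s * K" using True by blast
        then have "m = 1 + s * K" using m by linarith
        then have "m mod s = 1 mod s" by (simp only: mod_mult_self2)
        then show ?thesis using s by simp
      qed
      then have "\<delta> = 0" using exponents_mod[of m s] by (auto simp: \<delta>)
      then have "(y + (of_nat s - 1)) * (\<Sum>j\<le>k div s. \<phi> (k - s * j) j * y ^ j) +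
          cnj (\<phi> 0 ((m - 1) div s)) * y ^ ((m - 1) div s) = 0" for y
        using main[of y] True False by simp
      from polyfun_linear_factor[OF this s_neq]
      show ?thesis using \<open>\<delta> = 0\<close> False by simp
    next
      case F: False
      \<comment> \<open>Here no conjugate term and no \<open>\<gamma>\<close> survives;
        \<open>\<delta>\<close> takes the place of the extra monomial, with exponent 0.\<close>
      have "(y + (of_nat s - 1)) * (\<Sum>j\<le>k div s. \<phi> (k - s * j) j * y ^ j) + \<delta> * y ^ 0 = 0" for y
        using main[of y] F False by simp
      from polyfun_linear_factor[OF this s_neq]
      show ?thesis using False F by simp
    qed
  qed

  have "\<phi> i j = 0" if "(if i = 0 then 1 + s * j else s - 1 + i + s * j) < Suc m" for i j
  proof (cases "(if i = 0 then 1 + s * j else s - 1 + i + s * j) < m")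
    case False
    show ?thesis
    proof (cases "i = 0")
      case True
      then have j: "m - 1 = s * j" using False that by simp
      have "s dvd m - 1" "(m - 1) div s = j" unfolding j using s by simp_all
      then show ?thesis using kj True by simp
    next
      case i: False
      then have ij: "i + s * j = k" using False that k by simp
      then have "j * s \<le> k" by (simp add: mult.commute flip: ij)
      then have "j \<le> k div s" using s by (simp add: less_eq_div_iff_mult_less_eq)
      moreover have "k - s * j = i" using ij by simp
      ultimately show ?thesis using kj by auto
    qed
  qed (rule \<phi>)
  moreover have "\<gamma> 0 j = 0" if "s * j < Suc m" for j
  proof (cases "s * j = m")
    case True
    then have "m div s = j" "s dvd m" using s by auto
    then show ?thesis using kj by auto
  qed (use that in \<open>auto intro: \<gamma>\<close>)
  moreover have "a' n * \<alpha> ^ n = a n" if "n \<in> exponents s" "n < Suc m" for n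
    using triv that kj \<delta> unfolding trivial_below_def by (cases "n = m") auto
  ultimately show ?thesis unfolding trivial_below_def by blast
qed

lemma coefficients_eq:
  assumes "n \<in> exponents s"
  shows "a' n * \<alpha> ^ n = a n"
proof -
  have "trivial_below (Suc s + d)" for d
    by (induction d) (auto intro: trivial_below_base trivial_below_step)
  from this[of n] show ?thesis using assms unfolding trivial_below_def by simp
qed

end

section \<open>Consequences for the surface and its truncations\<close>

theorem formally_equivalent_imp_same_support:
  assumes "s \<ge> 3" "formally_equivalent (bishop s a) (bishop s a')" "n \<in> exponents s"
  shows "a n = 0 \<longleftrightarrow> a' n = 0"
proof -
  obtain F1 F2 where "formal_transformation F1 F2" "maps_surface F1 F2 (bishop s a) (bishop s a')"
    using assms(2) by (auto simp: formally_equivalent_def)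
  then interpret bishop_equivalence s a a' F1 F2
    using assms(1) by unfold_locales
  \<comment> \<open>The coefficients differ by the factor \<open>\<alpha> ^ n\<close>, which is
    nonzero.\<close>
  show ?thesis
    using coefficients_eq[OF assms(3)] leading_coeffs_nonzero(1) by auto
qed

lemma formally_equivalent_refl:
  assumes "coeff2 H 0 0 = 0"
  shows "formally_equivalent H H"
proof -
  have var: "subst2 var1 A B = A" "subst2 var2 A B = B"
    if "coeff2 A 0 0 = 0" "coeff2 B 0 0 = 0" for A B
  proof -
    have fin: "finite {(i, j). i + j \<le> (m::nat)}" for m
      by (rule finite_subset[of _ "{..m} \<times> {..m}"]) auto
    \<comment> \<open>At order 0 the index of the linear monomial lies outside the triangle, and the
      vanishing constant term is what makes both sides agree.\<close>
    have zero: "coeff2 C m n = 0" if "coeff2 C 0 0 = 0" "\<not> Suc 0 \<le> m + n" for C m n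
    proof -
      have "m = 0" "n = 0" using that(2) by linarith+
      then show ?thesis using that(1) by simp
    qed
    show "subst2 var1 A B = A"
    proof (rule fps2_eqI)
      fix m n
      have "coeff2 (subst2 var1 A B) m n =
          (\<Sum>ij\<in>{(i, j). i + j \<le> m + n}. if ij = (1, 0) then coeff2 A m n else 0)"
        unfolding coeff2_subst2
        by (rule sum.cong) (auto simp: coeff2_def[of var1] split: if_splits)
      then show "coeff2 (subst2 var1 A B) m n = coeff2 A m n"
        using fin[of "m + n"] zero[of A m n] that by auto
    qed
    show "subst2 var2 A B = B"
    proof (rule fps2_eqI)
      fix m n
      have "coeff2 (subst2 var2 A B) m n =
          (\<Sum>ij\<in>{(i, j). i + j \<le> m + n}. if ij = (0, 1) then coeff2 B m n else 0)"
        unfolding coeff2_subst2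
        by (rule sum.cong) (auto simp: coeff2_def[of var2] split: if_splits)
      then show "coeff2 (subst2 var2 A B) m n = coeff2 B m n"
        using fin[of "m + n"] zero[of B m n] that by auto
    qed
  qed
  have "invertible (jacobian_at_0 var1 var2)"
    by (simp add: invertible_det_nz jacobian_at_0_def det_2 vector_2 coeff2_def)
  moreover have "coeff2 var1 0 0 = 0" "coeff2 var2 0 0 = 0" by (simp_all add: coeff2_def)
  moreover have "subst2 H var1 (conj2 var1) = H" by (simp add: conj2_var1 subst2_var1_var2)
  ultimately have "formal_transformation var1 var2" "maps_surface var1 var2 H H"
    using assms by (simp_all add: formal_transformation_def maps_surface_def var)
  then show ?thesis unfolding formally_equivalent_def by blast
qed

theorem corollary3p4:
  fixes s :: nat and a :: "nat \<Rightarrow> complex"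
  assumes "s \<ge> 3"
    and "infinite {n \<in> exponents s. a n \<noteq> 0}"
    and "convergent2 (bishop s a)"
  shows "(\<forall>N>s. \<not> formally_equivalent (bishop s a) (trunc2 N (bishop s a)) \<and>
                \<not> holomorphically_equivalent (bishop s a) (trunc2 N (bishop s a))) \<and>
         (\<forall>N>s. \<forall>N'>N.
            formally_equivalent (trunc2 N (bishop s a)) (trunc2 N' (bishop s a)) \<longleftrightarrow>
            (\<forall>k\<ge>1. \<forall>j\<in>{2..s - 1}. N < k * s + j \<and> k * s + j \<le> N' \<longrightarrow> a (k * s + j) = 0))"
proof (intro conjI allI impI)
  fix N assume N: "N > s"
  show not_equiv: "\<not> formally_equivalent (bishop s a) (trunc2 N (bishop s a))"
  proof
    assume "formally_equivalent (bishop s a) (trunc2 N (bishop s a))"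
    \<comment> \<open>The truncation is a Bishop surface whose coefficients beyond \<open>N\<close>
      are zero, so equality of supports would leave only finitely many nonzero
      \<open>a n\<close>.\<close>
    then have "a n = 0" if "n \<in> exponents s" "n > N" for n
      using formally_equivalent_imp_same_support[OF assms(1), of a "\<lambda>n. if n \<le> N then a n else 0" n]
        that trunc2_bishop[OF assms(1) N] by simp
    then have "{n \<in> exponents s. a n \<noteq> 0} \<subseteq> {..N}" by (auto simp: not_le[symmetric])
    then show False using assms(2) finite_subset by blast
  qed
  then show "\<not> holomorphically_equivalent (bishop s a) (trunc2 N (bishop s a))"
    unfolding holomorphically_equivalent_def formally_equivalent_def by blast
next
  fix N N' assume N: "N > s" "N' > N"
  let ?t = "\<lambda>N n. if n \<le> N then a n else 0"
  have t: "trunc2 N (bishop s a) = bishop s (?t N)" "trunc2 N' (bishop s a) = bishop s (?t N')"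
    using trunc2_bishop[OF assms(1)] N by simp_all
  show "formally_equivalent (trunc2 N (bishop s a)) (trunc2 N' (bishop s a)) \<longleftrightarrow>
      (\<forall>k\<ge>1. \<forall>j\<in>{2..s - 1}. N < k * s + j \<and> k * s + j \<le> N' \<longrightarrow> a (k * s + j) = 0)"
  proof
    assume equiv: "formally_equivalent (trunc2 N (bishop s a)) (trunc2 N' (bishop s a))"
    show "\<forall>k\<ge>1. \<forall>j\<in>{2..s - 1}. N < k * s + j \<and> k * s + j \<le> N' \<longrightarrow> a (k * s + j) = 0"
    proof (intro allI impI ballI)
      fix k j assume "k \<ge> 1" "j \<in> {2..s - 1}" and kj: "N < k * s + j \<and> k * s + j \<le> N'"
      then have "k * s + j \<in> exponents s" unfolding exponents_def by blast
      from formally_equivalent_imp_same_support[OF assms(1) equiv[unfolded t] this]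
      show "a (k * s + j) = 0" using kj by simp
    qed
  next
    assume zero: "\<forall>k\<ge>1. \<forall>j\<in>{2..s - 1}. N < k * s + j \<and> k * s + j \<le> N' \<longrightarrow> a (k * s + j) = 0"
    \<comment> \<open>The two truncations are then the same series, and the identity is an
      equivalence.\<close>
    have "?t N n = ?t N' n" if n: "n \<in> exponents s" for n
    proof -
      obtain k j where "n = k * s + j" "k \<ge> 1" "j \<in> {2..s - 1}"
        using n unfolding exponents_def by blast
      then show ?thesis using zero N by auto
    qed
    then have "bishop s (?t N) = bishop s (?t N')"
      unfolding bishop_def by (simp cong: if_cong)
    moreover have "coeff2 (bishop s (?t N)) 0 0 = 0"
      using assms(1) exponents_gt[of 0 s] by (auto simp: coeff2_bishop)
    ultimately show "formally_equivalent (trunc2 N (bishop s a)) (trunc2 N' (bishop s a))"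
      unfolding t using formally_equivalent_refl by metis
  qed
qed

end
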